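(* Let $A$ be an algebra of type $\Omega$, let $P$ be a pointed $A$-overalgebra, and let $\mathcal{M}P$ (with the homomorphism $\eta P:P\to\mathcal{U}\mathcal{M}P$) be its modulization. Let $\mathbf{V}$ be a variety of algebras of type $\Omega$ with $A\in\mathbf{V}$. Then: (1) $\mathcal{M}P$ satisfies any identity satisfied by $P$. (2) If $P$ is totally in $\mathbf{V}$, then $\mathcal{M}P$ is totally in $\mathbf{V}$. (3) If $P$ is totally in $\mathbf{V}$, then $\langle\mathcal{M}P,\eta P\rangle$ is a universal arrow from $P$ to the restriction $\mathcal{U}:\mathrm{Ab}[A,\mathbf{V}]\to\mathrm{Pnt}[A,\mathbf{V}]$ of the forgetful functor.
   Context: A type $\Omega$ is a family of sets $\Omega_n$ ($n\in\mathbb{N}$, $0\in\mathbb N$) of $n$-ary operation symbols; algebras may be empty. Let $A$ be an algebra of type $\Omega$. An $A$-module $M$ is an $|A|$-tuple of abelian groups $({}_aM)_{a\in A}$ with, for each $n$-ary $\omega$ and $\mathbf{a}\in A^n$, a group homomorphism $\omega^M_{\mathbf a}:{}_{\mathbf a}M\to{}_{\omega(\mathbf a)}M$, where ${}_{\mathbf a}M={}_{a_1}M\times\cdots\times{}_{a_n}M$. A pointed $A$-overalgebra $P$ is the same with pointed sets ${}_aP$ (basepoint ${}_a*$) and pointed maps in place of abelian groups and homomorphisms; the basepoint of ${}_{\mathbf a}P$ is $\langle{}_{a_1}*,\ldots,{}_{a_n}*\rangle$. A homomorphism $\phi:M\to M'$ (in either case) is an $A$-tuple of group homomorphisms (resp.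 pointed maps) ${}_a\phi:{}_aM\to{}_aM'$ with ${}_{\omega(\mathbf a)}\phi(\omega^M_{\mathbf a}(\mathbf m))=\omega^{M'}_{\mathbf a}({}_{a_1}\phi(m_1),\ldots,{}_{a_n}\phi(m_n))$. The categories are $\mathrm{Ab}[A]$ and $\mathrm{Pnt}[A]$. The forgetful functor $\mathcal{U}:\mathrm{Ab}[A]\to\mathrm{Pnt}[A]$ replaces each group ${}_aM$ by its underlying set with basepoint ${}_a0$. The total algebra $A\ltimes M$ is $\{\langle a,m\rangle: m\in{}_aM\}$ with operations $\omega(\langle a_1,m_1\rangle,\ldots,\langle a_n,m_n\rangle)=\langle\omega(\mathbf a),\omega^M_{\mathbf a}(\mathbf m)\rangle$. For $A\in\mathbf V$, $M$ is totally in $\mathbf V$ if $A\ltimes M\in\mathbf V$; $\mathrm{Ab}[A,\mathbf V]$, $\mathrm{Pnt}[A,\mathbf V]$ are the full subcategories of $A$-modules and pointed $A$-overalgebras totally in $\mathbf V$. The functor $\mathcal U$ restricts to $\mathrm{Ab}[A,\mathbf V]\to\mathrm{Pnt}[A,\mathbf V]$. For an $n$-ary term $t$ (element of the word algebra on $x_1,\ldots,x_n$), the maps $t^M_{\mathbf a}:{}_{\mathbf a}M\to{}_{t^A(\mathbf a)}M$ are given inductively by $(x_i)^M_{\mathbf a}(\mathbf m)=m_i$ and $(\omega(s_1,\ldots,s_k))^M_{\mathbf a}(\mathbf m)=\omega^M_{\langle s_1^A(\mathbf a),\ldots,s_k^A(\mathbf a)\rangle}((s_1)^M_{\mathbf a}(\mathbf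 m),\ldots,(s_k)^M_{\mathbf a}(\mathbf m))$. $M$ (an $A$-module or pointed $A$-overalgebra) satisfies the identity $t=t'$ if $A$ satisfies $t=t'$ and $t^M_{\mathbf a}=(t')^M_{\mathbf a}$ for all $\mathbf a$ (equivalently, $t^{A\ltimes M}=(t')^{A\ltimes M}$). Modulization. Given $P\in\mathrm{Pnt}[A]$, let $\hat{\mathcal M}P$ be the $A$-module with ${}_a(\hat{\mathcal M}P)$ the free abelian group on the set ${}_aP$ (elements of ${}_aP$ identified with generators) and $\omega^{\hat{\mathcal M}P}_{\mathbf a}(m_1,\ldots,m_n)=\sum_{i}\omega^{\hat{\mathcal M}P}_{\mathbf a,i}(m_i)$, where $\omega^{\hat{\mathcal M}P}_{\mathbf a,i}:{}_{a_i}(\hat{\mathcal M}P)\to{}_{\omega(\mathbf a)}(\hat{\mathcal M}P)$ is the group homomorphism with $\omega^{\hat{\mathcal M}P}_{\mathbf a,i}(p)=\omega^P_{\mathbf a}({}_{a_1}*,\ldots,{}_{a_{i-1}}*,p,{}_{a_{i+1}}*,\ldots,{}_{a_n}* )$ for $p\in{}_{a_i}P$. Let $\mathcal KP$ be the smallest submodule of $\hat{\mathcal M}P$ (family of subgroups closed under all $\omega_{\mathbf a}$) containing every ${}_a*\in{}_aP$ and every $\omega^P_{\mathbf a}(\mathbf p)-\sum_{i=1}^n\omega^{\hat{\mathcal M}P}_{\mathbf a,i}(p_i)$ ($\omega$ $n$-ary, $\mathbf a\in A^n$, $\mathbf p\in{}_{\mathbf a}P$). Then $\mathcal MP=\hat{\mathcal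 M}P/\mathcal KP$, and ${}_a(\eta P):{}_aP\to{}_a(\mathcal MP)$ sends $p$ to the class of the generator $p$. A universal arrow from $P$ to a functor $\mathcal U$ is a pair $\langle N,\eta\rangle$ with $\eta:P\to\mathcal UN$ such that for every $M$ and every $\zeta:P\to\mathcal UM$ there is a unique $\xi:N\to M$ with $\zeta=(\mathcal U\xi)\eta$. *)

theory Defs
  imports "HOL-Algebra.Algebra"
begin

section \<open>Algebras, terms, identities, varieties\<close>

text \<open>
  A type is a family \<open>\<Omega> :: nat \<Rightarrow> 'f set\<close>. Tuples are lists, and the arity of an occurrence of an
  operation symbol is the length of its argument list, so that the sets \<open>\<Omega> n\<close> need not be disjoint
  (a symbol in \<open>\<Omega> 2 \<inter> \<Omega> 3\<close> gives two unrelated operations). Carriers may be empty.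
\<close>

record ('f, 'a) alg =
  car :: "'a set"
  opn :: "'f \<Rightarrow> 'a list \<Rightarrow> 'a"

definition tuples :: "('f, 'a) alg \<Rightarrow> nat \<Rightarrow> 'a list set" where
  "tuples A n = {as. length as = n \<and> set as \<subseteq> car A}"

definition is_algebra :: "(nat \<Rightarrow> 'f set) \<Rightarrow> ('f, 'a) alg \<Rightarrow> bool" where
  "is_algebra \<Omega> A \<longleftrightarrow> (\<forall>n. \<forall>\<omega>\<in>\<Omega> n. \<forall>as\<in>tuples A n. opn A \<omega> as \<in> car A)"

text \<open>The variable \<open>x\<^sub>i\<close> of the informal notation is \<open>Var (i - 1)\<close>.\<close>

datatype 'f trm = Var nat | App 'f "'f trm list"

inductive_set terms :: "(nat \<Rightarrow> 'f set) \<Rightarrow> nat \<Rightarrow> 'f trm set"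
  for \<Omega> :: "nat \<Rightarrow> 'f set" and n :: nat where
  Var: "i < n \<Longrightarrow> Var i \<in> terms \<Omega> n"
| App: "\<omega> \<in> \<Omega> (length ts) \<Longrightarrow> \<forall>t\<in>set ts. t \<in> terms \<Omega> n \<Longrightarrow> App \<omega> ts \<in> terms \<Omega> n"

primrec teval :: "('f, 'a) alg \<Rightarrow> 'f trm \<Rightarrow> 'a list \<Rightarrow> 'a" where
  "teval A (Var i) as = as ! i"
| "teval A (App \<omega> ts) as = opn A \<omega> (map (\<lambda>t. teval A t as) ts)"

text \<open>An identity \<open>t = t'\<close> between \<open>n\<close>-ary terms is the triple \<open>(n, t, t')\<close>.\<close>

type_synonym 'f identity = "nat \<times> 'f trm \<times> 'f trm"

definition identities :: "(nat \<Rightarrow> 'f set) \<Rightarrow> 'f identity set" where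
  "identities \<Omega> = {(n, t, t'). t \<in> terms \<Omega> n \<and> t' \<in> terms \<Omega> n}"

definition alg_satisfies :: "('f, 'a) alg \<Rightarrow> 'f identity \<Rightarrow> bool" where
  "alg_satisfies A = (\<lambda>(n, t, t'). \<forall>as\<in>tuples A n. teval A t as = teval A t' as)"

text \<open>
  A variety is an equational class. Since it has to contain algebras over different HOL types, it is
  represented by a set \<open>E \<subseteq> identities \<Omega>\<close> that defines it.
\<close>

definition in_variety :: "(nat \<Rightarrow> 'f set) \<Rightarrow> 'f identity set \<Rightarrow> ('f, 'a) alg \<Rightarrow> bool" where
  "in_variety \<Omega> E A \<longleftrightarrow> is_algebra \<Omega> A \<and> (\<forall>e\<in>E. alg_satisfies A e)"


section \<open>Pointed overalgebras and modules\<close>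

record ('f, 'a, 'p) pointed_overalgebra =
  fib :: "'a \<Rightarrow> 'p set"
  pt :: "'a \<Rightarrow> 'p"
  pop :: "'f \<Rightarrow> 'a list \<Rightarrow> 'p list \<Rightarrow> 'p"

record ('f, 'a, 'm) amodule =
  grp :: "'a \<Rightarrow> 'm monoid"
  mop :: "'f \<Rightarrow> 'a list \<Rightarrow> 'm list \<Rightarrow> 'm"

text \<open>The product of the fibers over the entries of a tuple of indices.\<close>

definition fibs :: "('f, 'a, 'p) pointed_overalgebra \<Rightarrow> 'a list \<Rightarrow> 'p list set" where
  "fibs P as = listset (map (fib P) as)"

definition is_pointed_overalgebra ::
  "(nat \<Rightarrow> 'f set) \<Rightarrow> ('f, 'a) alg \<Rightarrow> ('f, 'a, 'p) pointed_overalgebra \<Rightarrow> bool" where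
  "is_pointed_overalgebra \<Omega> A P \<longleftrightarrow>
     (\<forall>a\<in>car A. pt P a \<in> fib P a) \<and>
     (\<forall>n. \<forall>\<omega>\<in>\<Omega> n. \<forall>as\<in>tuples A n.
        pop P \<omega> as \<in> fibs P as \<rightarrow> fib P (opn A \<omega> as) \<and>
        pop P \<omega> as (map (pt P) as) = pt P (opn A \<omega> as))"

definition product_group_list :: "'m monoid list \<Rightarrow> 'm list monoid" where
  "product_group_list Gs =
     \<lparr>carrier = listset (map carrier Gs),
      monoid.mult = (\<lambda>xs ys. map (\<lambda>i. xs ! i \<otimes>\<^bsub>Gs ! i\<^esub> ys ! i) [0..<length Gs]),
      one = map one Gs\<rparr>"

definition is_module :: "(nat \<Rightarrow> 'f set) \<Rightarrow> ('f, 'a) alg \<Rightarrow> ('f, 'a, 'm) amodule \<Rightarrow> bool" where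
  "is_module \<Omega> A M \<longleftrightarrow>
     (\<forall>a\<in>car A. comm_group (grp M a)) \<and>
     (\<forall>n. \<forall>\<omega>\<in>\<Omega> n. \<forall>as\<in>tuples A n.
        mop M \<omega> as \<in> hom (product_group_list (map (grp M) as)) (grp M (opn A \<omega> as)))"

definition forget :: "('f, 'a, 'm) amodule \<Rightarrow> ('f, 'a, 'm) pointed_overalgebra" where
  "forget M = \<lparr>fib = (\<lambda>a. carrier (grp M a)), pt = (\<lambda>a. \<one>\<^bsub>grp M a\<^esub>), pop = mop M\<rparr>"

text \<open>
  Morphisms are families of functions that are \<^const>\<open>undefined\<close> off their domains, so that equality
  of morphisms is HOL equality. The forgetful functor acts on morphisms as the identity.
\<close>

definition pointed_hom ::
  "(nat \<Rightarrow> 'f set) \<Rightarrow> ('f, 'a) alg \<Rightarrow> ('f, 'a, 'p) pointed_overalgebra \<Rightarrow>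
   ('f, 'a, 'q) pointed_overalgebra \<Rightarrow> ('a \<Rightarrow> 'p \<Rightarrow> 'q) set" where
  "pointed_hom \<Omega> A P Q =
     {\<phi> \<in> (\<Pi>\<^sub>E a\<in>car A. {f \<in> fib P a \<rightarrow>\<^sub>E fib Q a. f (pt P a) = pt Q a}).
        \<forall>n. \<forall>\<omega>\<in>\<Omega> n. \<forall>as\<in>tuples A n. \<forall>ps\<in>fibs P as.
          \<phi> (opn A \<omega> as) (pop P \<omega> as ps) = pop Q \<omega> as (map2 \<phi> as ps)}"

definition module_hom ::
  "(nat \<Rightarrow> 'f set) \<Rightarrow> ('f, 'a) alg \<Rightarrow> ('f, 'a, 'm) amodule \<Rightarrow>
   ('f, 'a, 'k) amodule \<Rightarrow> ('a \<Rightarrow> 'm \<Rightarrow> 'k) set" where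
  "module_hom \<Omega> A M N =
     {\<phi> \<in> (\<Pi>\<^sub>E a\<in>car A. hom (grp M a) (grp N a) \<inter> extensional (carrier (grp M a))).
        \<forall>n. \<forall>\<omega>\<in>\<Omega> n. \<forall>as\<in>tuples A n. \<forall>ms\<in>fibs (forget M) as.
          \<phi> (opn A \<omega> as) (mop M \<omega> as ms) = mop N \<omega> as (map2 \<phi> as ms)}"

definition family_comp ::
  "('f, 'a) alg \<Rightarrow> ('f, 'a, 'p) pointed_overalgebra \<Rightarrow>
   ('a \<Rightarrow> 'q \<Rightarrow> 'r) \<Rightarrow> ('a \<Rightarrow> 'p \<Rightarrow> 'q) \<Rightarrow> 'a \<Rightarrow> 'p \<Rightarrow> 'r" where
  "family_comp A P \<xi> \<eta> = (\<lambda>a\<in>car A. compose (fib P a) (\<xi> a) (\<eta> a))"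


section \<open>Total algebras and identities of overalgebras\<close>

text \<open>
  The total algebra and the maps \<open>t\<^sup>M\<^sub>a\<close> do not depend on the group structure of a module \<open>M\<close>; for
  modules the following notions are applied to \<^term>\<open>forget M\<close>, which has the same fibers and operations.
\<close>

definition total_algebra ::
  "('f, 'a) alg \<Rightarrow> ('f, 'a, 'p) pointed_overalgebra \<Rightarrow> ('f, 'a \<times> 'p) alg" where
  "total_algebra A P = \<lparr>car = Sigma (car A) (fib P),
     opn = (\<lambda>\<omega> xs. (opn A \<omega> (map fst xs), pop P \<omega> (map fst xs) (map snd xs)))\<rparr>"

primrec oeval ::
  "('f, 'a) alg \<Rightarrow> ('f, 'a, 'p) pointed_overalgebra \<Rightarrow> 'f trm \<Rightarrow> 'a list \<Rightarrow> 'p list \<Rightarrow> 'p" where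
  "oeval A P (Var i) as ps = ps ! i"
| "oeval A P (App \<omega> ts) as ps =
     pop P \<omega> (map (\<lambda>t. teval A t as) ts) (map (\<lambda>t. oeval A P t as ps) ts)"

definition satisfies ::
  "('f, 'a) alg \<Rightarrow> ('f, 'a, 'p) pointed_overalgebra \<Rightarrow> 'f identity \<Rightarrow> bool" where
  "satisfies A P = (\<lambda>(n, t, t').
     alg_satisfies A (n, t, t') \<and>
     (\<forall>as\<in>tuples A n. \<forall>ps\<in>fibs P as. oeval A P t as ps = oeval A P t' as ps))"

definition totally_in ::
  "(nat \<Rightarrow> 'f set) \<Rightarrow> 'f identity set \<Rightarrow> ('f, 'a) alg \<Rightarrow> ('f, 'a, 'p) pointed_overalgebra \<Rightarrow> bool" where
  "totally_in \<Omega> E A P \<longleftrightarrow> in_variety \<Omega> E (total_algebra A P)"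

definition Pnt_obj ::
  "(nat \<Rightarrow> 'f set) \<Rightarrow> ('f, 'a) alg \<Rightarrow> 'f identity set \<Rightarrow> ('f, 'a, 'p) pointed_overalgebra \<Rightarrow> bool" where
  "Pnt_obj \<Omega> A E P \<longleftrightarrow> is_pointed_overalgebra \<Omega> A P \<and> totally_in \<Omega> E A P"

definition Ab_obj ::
  "(nat \<Rightarrow> 'f set) \<Rightarrow> ('f, 'a) alg \<Rightarrow> 'f identity set \<Rightarrow> ('f, 'a, 'm) amodule \<Rightarrow> bool" where
  "Ab_obj \<Omega> A E M \<longleftrightarrow> is_module \<Omega> A M \<and> totally_in \<Omega> E A (forget M)"

text \<open>
  \<open>(N, \<eta>)\<close> is a universal arrow from \<open>P\<close> to the forgetful functor from modules to pointed overalgebras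
  totally in the variety. HOL cannot quantify over types inside a definition, so the type \<open>'m\<close> of the
  elements of the test modules is a parameter; universality means that this holds for every \<open>'m\<close>.
\<close>

definition universal_arrow ::
  "'m itself \<Rightarrow> (nat \<Rightarrow> 'f set) \<Rightarrow> ('f, 'a) alg \<Rightarrow> 'f identity set \<Rightarrow>
   ('f, 'a, 'p) pointed_overalgebra \<Rightarrow> ('f, 'a, 'k) amodule \<Rightarrow> ('a \<Rightarrow> 'p \<Rightarrow> 'k) \<Rightarrow> bool" where
  "universal_arrow _ \<Omega> A E P N \<eta> \<longleftrightarrow>
     Pnt_obj \<Omega> A E P \<and> Ab_obj \<Omega> A E N \<and> \<eta> \<in> pointed_hom \<Omega> A P (forget N) \<and>
     (\<forall>M :: ('f, 'a, 'm) amodule. Ab_obj \<Omega> A E M \<longrightarrow>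
        (\<forall>\<zeta>\<in>pointed_hom \<Omega> A P (forget M).
           \<exists>!\<xi>. \<xi> \<in> module_hom \<Omega> A N M \<and> \<zeta> = family_comp A P \<xi> \<eta>))"


section \<open>Modulization\<close>

definition free_op_at ::
  "('f, 'a, 'p) pointed_overalgebra \<Rightarrow> 'f \<Rightarrow> 'a list \<Rightarrow> nat \<Rightarrow> ('p \<Rightarrow>\<^sub>0 int) \<Rightarrow> ('p \<Rightarrow>\<^sub>0 int)" where
  "free_op_at P \<omega> as i = frag_extend (\<lambda>p. frag_of (pop P \<omega> as ((map (pt P) as)[i := p])))"

definition free_modulization ::
  "('f, 'a, 'p) pointed_overalgebra \<Rightarrow> ('f, 'a, 'p \<Rightarrow>\<^sub>0 int) amodule" where
  "free_modulization P =
     \<lparr>grp = (\<lambda>a. free_Abelian_group (fib P a)),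
      mop = (\<lambda>\<omega> as ms. \<Sum>i<length as. free_op_at P \<omega> as i (ms ! i))\<rparr>"

definition is_submodule ::
  "(nat \<Rightarrow> 'f set) \<Rightarrow> ('f, 'a) alg \<Rightarrow> ('f, 'a, 'm) amodule \<Rightarrow> ('a \<Rightarrow> 'm set) \<Rightarrow> bool" where
  "is_submodule \<Omega> A M S \<longleftrightarrow>
     (\<forall>a\<in>car A. subgroup (S a) (grp M a)) \<and>
     (\<forall>n. \<forall>\<omega>\<in>\<Omega> n. \<forall>as\<in>tuples A n. \<forall>ms\<in>listset (map S as). mop M \<omega> as ms \<in> S (opn A \<omega> as))"

definition contains_relators ::
  "(nat \<Rightarrow> 'f set) \<Rightarrow> ('f, 'a) alg \<Rightarrow> ('f, 'a, 'p) pointed_overalgebra \<Rightarrow>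
   ('a \<Rightarrow> ('p \<Rightarrow>\<^sub>0 int) set) \<Rightarrow> bool" where
  "contains_relators \<Omega> A P S \<longleftrightarrow>
     (\<forall>a\<in>car A. frag_of (pt P a) \<in> S a) \<and>
     (\<forall>n. \<forall>\<omega>\<in>\<Omega> n. \<forall>as\<in>tuples A n. \<forall>ps\<in>fibs P as.
        frag_of (pop P \<omega> as ps) - (\<Sum>i<n. free_op_at P \<omega> as i (frag_of (ps ! i)))
          \<in> S (opn A \<omega> as))"

definition modulization_kernel ::
  "(nat \<Rightarrow> 'f set) \<Rightarrow> ('f, 'a) alg \<Rightarrow> ('f, 'a, 'p) pointed_overalgebra \<Rightarrow>
   'a \<Rightarrow> ('p \<Rightarrow>\<^sub>0 int) set" where
  "modulization_kernel \<Omega> A P a =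
     \<Inter> {S a | S. is_submodule \<Omega> A (free_modulization P) S \<and> contains_relators \<Omega> A P S}"

text \<open>
  The operation of the quotient on cosets is the union of the cosets of the results over all choices
  of representatives; for a submodule \<open>K\<close> these cosets all coincide.
\<close>

definition quotient_module ::
  "('f, 'a) alg \<Rightarrow> ('f, 'a, 'm) amodule \<Rightarrow> ('a \<Rightarrow> 'm set) \<Rightarrow> ('f, 'a, 'm set) amodule" where
  "quotient_module A M K =
     \<lparr>grp = (\<lambda>a. grp M a Mod K a),
      mop = (\<lambda>\<omega> as cs. \<Union>ms\<in>listset cs. K (opn A \<omega> as) #>\<^bsub>grp M (opn A \<omega> as)\<^esub> mop M \<omega> as ms)\<rparr>"

definition modulization ::
  "(nat \<Rightarrow> 'f set) \<Rightarrow> ('f, 'a) alg \<Rightarrow> ('f, 'a, 'p) pointed_overalgebra \<Rightarrow>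
   ('f, 'a, ('p \<Rightarrow>\<^sub>0 int) set) amodule" where
  "modulization \<Omega> A P = quotient_module A (free_modulization P) (modulization_kernel \<Omega> A P)"

definition modulization_unit ::
  "(nat \<Rightarrow> 'f set) \<Rightarrow> ('f, 'a) alg \<Rightarrow> ('f, 'a, 'p) pointed_overalgebra \<Rightarrow>
   'a \<Rightarrow> 'p \<Rightarrow> ('p \<Rightarrow>\<^sub>0 int) set" where
  "modulization_unit \<Omega> A P =
     (\<lambda>a\<in>car A. \<lambda>p\<in>fib P a. modulization_kernel \<Omega> A P a #>\<^bsub>free_Abelian_group (fib P a)\<^esub> frag_of p)"

end

theory Submission
  imports Defs
begin

text \<open>
  For a module \<open>M\<close>, every term map \<open>t\<^sup>M\<^sub>a\<close> is a group homomorphism on a product of fibers, since it is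
  composed from homomorphisms. Such a map is determined by its values on the tuples that are zero off one
  place and have a generator there. For the modulization, the generators are the \<open>\<eta>(p)\<close>, and
  such a tuple is the image under \<open>\<eta>\<close> of \<open>(*,\<dots>,p,\<dots>,*)\<close>. As \<open>\<eta>\<close> commutes with term maps, an identity of \<open>P\<close>
  holds on all these tuples, hence everywhere. For universality, a pointed homomorphism \<open>\<zeta>\<close> into a module
  extends to the free modulization; the extension commutes with the operations by the same principle,
  so its kernel is a submodule, which contains the relators because \<open>\<zeta>\<close> commutes with the operations.
\<close>

section \<open>Products and terms\<close>

lemma listset_iff:
  "xs \<in> listset Ss \<longleftrightarrow> length xs = length Ss \<and> (\<forall>i<length Ss. xs ! i \<in> Ss ! i)"
proof (induction Ss arbitrary: xs)
  case Nil
  then show ?case by auto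
next
  case (Cons S Ss)
  then show ?case
    by (cases xs) (auto simp: set_Cons_def All_less_Suc2)
qed

lemma fibs_iff:
  "ps \<in> fibs P as \<longleftrightarrow> length ps = length as \<and> (\<forall>i<length as. ps ! i \<in> fib P (as ! i))"
  by (auto simp: fibs_def listset_iff)

lemma tuples_iff: "as \<in> tuples A n \<longleftrightarrow> length as = n \<and> (\<forall>i<n. as ! i \<in> car A)"
  by (auto simp: tuples_def in_set_conv_nth subset_iff)

lemma carrier_product_group_list_iff:
  "xs \<in> carrier (product_group_list Gs) \<longleftrightarrow>
     length xs = length Gs \<and> (\<forall>i<length Gs. xs ! i \<in> carrier (Gs ! i))"
  by (auto simp: product_group_list_def listset_iff)

lemma one_product_group_list [simp]: "\<one>\<^bsub>product_group_list Gs\<^esub> = map one Gs"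
  by (simp add: product_group_list_def)

lemma length_mult_product_group_list [simp]:
  "length (xs \<otimes>\<^bsub>product_group_list Gs\<^esub> ys) = length Gs"
  by (simp add: product_group_list_def)

lemma nth_mult_product_group_list [simp]:
  "i < length Gs \<Longrightarrow> (xs \<otimes>\<^bsub>product_group_list Gs\<^esub> ys) ! i = xs ! i \<otimes>\<^bsub>Gs ! i\<^esub> ys ! i"
  by (simp add: product_group_list_def)

lemma group_product_group_list:
  assumes "\<And>i. i < length Gs \<Longrightarrow> group (Gs ! i)"
  shows "group (product_group_list Gs)"
proof (rule groupI)
  fix xs assume xs: "xs \<in> carrier (product_group_list Gs)"
  let ?ys = "map2 (\<lambda>G x. inv\<^bsub>G\<^esub> x) Gs xs"
  have "?ys \<in> carrier (product_group_list Gs)"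
    using xs assms by (auto simp: carrier_product_group_list_iff)
  moreover have "?ys \<otimes>\<^bsub>product_group_list Gs\<^esub> xs = \<one>\<^bsub>product_group_list Gs\<^esub>"
    using xs assms
    by (intro nth_equalityI) (auto simp: carrier_product_group_list_iff group.l_inv)
  ultimately show "\<exists>ys\<in>carrier (product_group_list Gs).
      ys \<otimes>\<^bsub>product_group_list Gs\<^esub> xs = \<one>\<^bsub>product_group_list Gs\<^esub>"
    by blast
qed (use assms in \<open>auto simp: carrier_product_group_list_iff group.is_monoid monoid.m_closed
       monoid.one_closed monoid.m_assoc monoid.l_one intro!: nth_equalityI\<close>)

text \<open>This is the coordinate injection of the \<open>i\<close>-th factor. Composing with it
  turns a homomorphism on the product into one on a single factor, where a generating set is at
  hand.\<close>

lemma product_group_list_injection_hom: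
  assumes "\<And>j. j < length Gs \<Longrightarrow> group (Gs ! j)" and "i < length Gs"
  shows "(\<lambda>x. (map one Gs)[i := x]) \<in> hom (Gs ! i) (product_group_list Gs)"
proof (rule homI)
  fix x assume "x \<in> carrier (Gs ! i)"
  then show "(map one Gs)[i := x] \<in> carrier (product_group_list Gs)"
    using assms by (auto simp: carrier_product_group_list_iff nth_list_update
        group.is_monoid monoid.one_closed)
next
  fix x y assume "x \<in> carrier (Gs ! i)" "y \<in> carrier (Gs ! i)"
  then show "(map one Gs)[i := x \<otimes>\<^bsub>Gs ! i\<^esub> y] =
      (map one Gs)[i := x] \<otimes>\<^bsub>product_group_list Gs\<^esub> (map one Gs)[i := y]"
    using assms by (intro nth_equalityI)
      (auto simp: nth_list_update group.is_monoid monoid.one_closed monoid.l_one)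
qed

lemma group_hom_eq_on_generate:
  assumes "group G" "group H" "f \<in> hom G H" "g \<in> hom G H" "S \<subseteq> carrier G"
    and "\<And>x. x \<in> S \<Longrightarrow> f x = g x" and "y \<in> generate G S"
  shows "f y = g y"
proof -
  interpret f: group_hom G H f
    using assms by (simp add: group_hom_def group_hom_axioms_def)
  interpret g: group_hom G H g
    using assms by (simp add: group_hom_def group_hom_axioms_def)
  show ?thesis
    using assms(7)
  proof induction
    case (inv x)
    then show ?case using assms(5,6) by (simp add: subset_iff)
  next
    case (eng x y)
    then show ?case using f.G.generate_in_carrier[OF assms(5)] by simp
  qed (use assms(6) in auto)
qed

text \<open>Every tuple is a product of tuples that are neutral off one place, so agreement on these
  suffices; at a fixed place, agreement spreads from the generating set \<open>S i\<close> to the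
  whole factor. All later comparisons of maps on products of fibers go through this
  principle.\<close>

lemma product_group_list_hom_eqI:
  assumes Gs: "\<And>i. i < length Gs \<Longrightarrow> group (Gs ! i)" and H: "group H"
    and f: "f \<in> hom (product_group_list Gs) H" and g: "g \<in> hom (product_group_list Gs) H"
    and S: "\<And>i. i < length Gs \<Longrightarrow> S i \<subseteq> carrier (Gs ! i)"
      "\<And>i. i < length Gs \<Longrightarrow> generate (Gs ! i) (S i) = carrier (Gs ! i)"
    and eqS: "\<And>i x. i < length Gs \<Longrightarrow> x \<in> S i \<Longrightarrow>
               f ((map one Gs)[i := x]) = g ((map one Gs)[i := x])"
    and xs: "xs \<in> carrier (product_group_list Gs)"
  shows "f xs = g xs"
proof -
  let ?ones = "map one Gs"
  \<comment> \<open>Precomposing with the coordinate injection gives two homomorphisms on the single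
    group \<open>Gs ! i\<close>, which agree on its generators.\<close>
  have eq: "f (?ones[i := x]) = g (?ones[i := x])"
    if i: "i < length Gs" and x: "x \<in> carrier (Gs ! i)" for i x
  proof -
    note inj = product_group_list_injection_hom[OF Gs i]
    have "(f \<circ> (\<lambda>x. ?ones[i := x])) x = (g \<circ> (\<lambda>x. ?ones[i := x])) x"
    proof (rule group_hom_eq_on_generate[OF Gs[OF i] H hom_compose[OF inj f] hom_compose[OF inj g]])
      show "S i \<subseteq> carrier (Gs ! i)" "x \<in> generate (Gs ! i) (S i)"
        using S[OF i] x by simp_all
      show "(f \<circ> (\<lambda>x. ?ones[i := x])) y = (g \<circ> (\<lambda>x. ?ones[i := x])) y" if "y \<in> S i" for y
        using eqS[OF i that] by simp
    qed
    then show ?thesis by simp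
  qed
  have len: "length xs = length Gs" and mem: "\<And>i. i < length Gs \<Longrightarrow> xs ! i \<in> carrier (Gs ! i)"
    using xs by (auto simp: carrier_product_group_list_iff)
  \<comment> \<open>The entries of the neutral tuple are replaced by those of \<open>xs\<close> one
    at a time: \<open>k = 0\<close> is the neutral tuple and \<open>k = length Gs\<close> is
    \<open>xs\<close> itself.\<close>
  have "f (take k xs @ drop k ?ones) = g (take k xs @ drop k ?ones)" if "k \<le> length Gs" for k
    using that
  proof (induction k)
    case 0
    have "f ?ones = \<one>\<^bsub>H\<^esub>" "g ?ones = \<one>\<^bsub>H\<^esub>"
      using hom_one[OF f group_product_group_list[OF Gs] H]
        hom_one[OF g group_product_group_list[OF Gs] H] by simp_all
    then show ?case by simp
  next
    case (Suc k)
    let ?x = "take k xs @ drop k ?ones" and ?y = "?ones[k := xs ! k]"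
    have k: "k < length Gs" using Suc.prems by simp
    have xy: "?x \<in> carrier (product_group_list Gs)" "?y \<in> carrier (product_group_list Gs)"
      using k len mem Gs
      by (auto simp: carrier_product_group_list_iff nth_append nth_list_update
          group.is_monoid monoid.one_closed)
    \<comment> \<open>In every coordinate at least one of the two factors is neutral, so the product
      fills in place \<open>k\<close> and changes nothing else.\<close>
    have "take (Suc k) xs @ drop (Suc k) ?ones = ?x \<otimes>\<^bsub>product_group_list Gs\<^esub> ?y"
      using k len mem Gs
      by (intro nth_equalityI) (auto simp: nth_append nth_list_update less_Suc_eq
          group.is_monoid monoid.one_closed monoid.l_one monoid.r_one)
    then show ?case
      using hom_mult[OF f xy] hom_mult[OF g xy] Suc eq[OF k mem[OF k]] by simp
  qed
  from this[of "length Gs"] show ?thesis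
    using len by simp
qed

section \<open>Term maps of overalgebras and modules\<close>

lemma teval_closed:
  assumes "is_algebra \<Omega> A" "t \<in> terms \<Omega> n" "as \<in> tuples A n"
  shows "teval A t as \<in> car A"
  using assms(2)
proof induction
  case (Var i)
  then show ?case using assms(3) by (simp add: tuples_iff)
next
  case (App \<omega> ts)
  then have "map (\<lambda>t. teval A t as) ts \<in> tuples A (length ts)"
    by (auto simp: tuples_def)
  then show ?case
    using App.hyps assms(1) by (simp add: is_algebra_def)
qed

lemma teval_map_tuples:
  assumes "is_algebra \<Omega> A" "\<forall>t\<in>set ts. t \<in> terms \<Omega> n" "as \<in> tuples A n"
  shows "map (\<lambda>t. teval A t as) ts \<in> tuples A (length ts)"
  using assms teval_closed by (fastforce simp: tuples_def)

lemma pop_closed: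
  assumes "is_pointed_overalgebra \<Omega> A P" "\<omega> \<in> \<Omega> n" "as \<in> tuples A n" "ps \<in> fibs P as"
  shows "pop P \<omega> as ps \<in> fib P (opn A \<omega> as)"
  using assms by (auto simp: is_pointed_overalgebra_def Pi_iff)

lemma oeval_closed:
  assumes "is_algebra \<Omega> A" "is_pointed_overalgebra \<Omega> A P"
    and "t \<in> terms \<Omega> n" "as \<in> tuples A n" "ps \<in> fibs P as"
  shows "oeval A P t as ps \<in> fib P (teval A t as)"
  using assms(3)
proof induction
  case (Var i)
  then show ?case using assms(4,5) by (simp add: tuples_iff fibs_iff)
next
  case (App \<omega> ts)
  have "map (\<lambda>t. teval A t as) ts \<in> tuples A (length ts)"
    using App assms(1,4) by (intro teval_map_tuples[where n = n]) auto
  moreover have "map (\<lambda>t. oeval A P t as ps) ts \<in> fibs P (map (\<lambda>t. teval A t as) ts)"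
    using App by (simp add: fibs_iff)
  ultimately show ?case
    using App.hyps assms(2) by (simp add: pop_closed)
qed

lemma pointed_hom_pop:
  assumes "\<phi> \<in> pointed_hom \<Omega> A P Q" "\<omega> \<in> \<Omega> n" "as \<in> tuples A n" "ps \<in> fibs P as"
  shows "\<phi> (opn A \<omega> as) (pop P \<omega> as ps) = pop Q \<omega> as (map2 \<phi> as ps)"
  using assms by (auto simp: pointed_hom_def)

text \<open>Induction on the term; closedness of the subterm values allows \<open>\<phi>\<close> to
  be moved past the outermost operation. With the unit as \<open>\<phi>\<close>, an identity of
  \<open>P\<close> becomes an equation at tuples in the image of \<open>P\<close>.\<close>

lemma pointed_hom_oeval:
  assumes "is_algebra \<Omega> A" "is_pointed_overalgebra \<Omega> A P" "\<phi> \<in> pointed_hom \<Omega> A P Q"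
    and "t \<in> terms \<Omega> n" "as \<in> tuples A n" "ps \<in> fibs P as"
  shows "\<phi> (teval A t as) (oeval A P t as ps) = oeval A Q t as (map2 \<phi> as ps)"
  using assms(4)
proof induction
  case (Var i)
  then show ?case using assms(5,6) by (simp add: tuples_iff fibs_iff)
next
  case (App \<omega> ts)
  have "map (\<lambda>t. teval A t as) ts \<in> tuples A (length ts)"
    using App assms(1,5) by (intro teval_map_tuples[where n = n]) auto
  moreover have "map (\<lambda>t. oeval A P t as ps) ts \<in> fibs P (map (\<lambda>t. teval A t as) ts)"
    using App.IH oeval_closed[OF assms(1,2) _ assms(5,6)] by (simp add: fibs_iff)
  ultimately have "\<phi> (opn A \<omega> (map (\<lambda>t. teval A t as) ts))
      (pop P \<omega> (map (\<lambda>t. teval A t as) ts) (map (\<lambda>t. oeval A P t as ps) ts)) =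
    pop Q \<omega> (map (\<lambda>t. teval A t as) ts)
      (map2 \<phi> (map (\<lambda>t. teval A t as) ts) (map (\<lambda>t. oeval A P t as ps) ts))"
    using App.hyps assms(3) pointed_hom_pop by metis
  moreover have "map2 \<phi> (map (\<lambda>t. teval A t as) ts) (map (\<lambda>t. oeval A P t as ps) ts) =
      map (\<lambda>t. oeval A Q t as (map2 \<phi> as ps)) ts"
    using App by (intro nth_equalityI) auto
  ultimately show ?case by simp
qed

lemma forget_simps [simp]:
  "fib (forget M) a = carrier (grp M a)" "pt (forget M) a = \<one>\<^bsub>grp M a\<^esub>" "pop (forget M) = mop M"
  by (simp_all add: forget_def)

lemma module_group: "is_module \<Omega> A M \<Longrightarrow> a \<in> car A \<Longrightarrow> group (grp M a)"
  by (simp add: is_module_def comm_group_def)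

lemma module_mop_hom:
  "is_module \<Omega> A M \<Longrightarrow> \<omega> \<in> \<Omega> n \<Longrightarrow> as \<in> tuples A n \<Longrightarrow>
     mop M \<omega> as \<in> hom (product_group_list (map (grp M) as)) (grp M (opn A \<omega> as))"
  by (simp add: is_module_def)

lemma fibs_forget: "fibs (forget M) as = carrier (product_group_list (map (grp M) as))"
  by (auto simp: fibs_iff carrier_product_group_list_iff)

text \<open>The tuple of base points of \<open>forget M\<close> is the neutral element of the
  product group, so preservation of base points is preservation of the neutral element by a
  homomorphism. Results on overalgebras thereby become available for modules.\<close>

lemma is_pointed_overalgebra_forget:
  assumes "is_algebra \<Omega> A" "is_module \<Omega> A M"
  shows "is_pointed_overalgebra \<Omega> A (forget M)"
  unfolding is_pointed_overalgebra_def
proof (intro conjI ballI allI)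
  fix a assume "a \<in> car A"
  then show "pt (forget M) a \<in> fib (forget M) a"
    using assms(2) module_group by (fastforce simp: group.is_monoid monoid.one_closed)
next
  fix n \<omega> as assume *: "\<omega> \<in> \<Omega> n" "as \<in> tuples A n"
  note hom = module_mop_hom[OF assms(2) *]
  show "pop (forget M) \<omega> as \<in> fibs (forget M) as \<rightarrow> fib (forget M) (opn A \<omega> as)"
    using hom by (auto simp: fibs_forget hom_def)
  have "group (product_group_list (map (grp M) as))"
    using * assms by (intro group_product_group_list) (auto simp: tuples_iff module_group)
  moreover have "group (grp M (opn A \<omega> as))"
    using * assms by (simp add: is_algebra_def module_group)
  moreover have "map (pt (forget M)) as = \<one>\<^bsub>product_group_list (map (grp M) as)\<^esub>"
    by simp
  ultimately show "pop (forget M) \<omega> as (map (pt (forget M)) as) = pt (forget M) (opn A \<omega> as)"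
    using hom_one[OF hom] by (metis forget_simps(2,3))
qed

text \<open>A variable gives a coordinate projection. A composite term gives an operation of
  \<open>M\<close> after the tuple of the subterm maps, and such a tuple of homomorphisms is a
  homomorphism into the product.\<close>

lemma oeval_hom:
  assumes A: "is_algebra \<Omega> A" and M: "is_module \<Omega> A M"
    and "t \<in> terms \<Omega> n" and as: "as \<in> tuples A n"
  shows "oeval A (forget M) t as \<in> hom (product_group_list (map (grp M) as)) (grp M (teval A t as))"
  using assms(3)
proof induction
  case (Var i)
  then show ?case
    using as by (intro homI) (auto simp: carrier_product_group_list_iff tuples_iff)
next
  case (App \<omega> ts)
  let ?bs = "map (\<lambda>t. teval A t as) ts" and ?f = "\<lambda>ms. map (\<lambda>t. oeval A (forget M) t as ms) ts"
  let ?G = "product_group_list (map (grp M) as)" and ?H = "product_group_list (map (grp M) ?bs)"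
  have hom: "oeval A (forget M) (ts ! i) as \<in> hom ?G (grp M (teval A (ts ! i) as))"
    if "i < length ts" for i
    using that App.IH by auto
  have "?f \<in> hom ?G ?H"
  proof (rule homI)
    fix ms assume "ms \<in> carrier ?G"
    then show "?f ms \<in> carrier ?H"
      using hom by (auto simp: carrier_product_group_list_iff[of "?f ms"] dest: hom_in_carrier)
  next
    fix ms ms' assume "ms \<in> carrier ?G" "ms' \<in> carrier ?G"
    then show "?f (ms \<otimes>\<^bsub>?G\<^esub> ms') = ?f ms \<otimes>\<^bsub>?H\<^esub> ?f ms'"
      using hom by (intro nth_equalityI) (auto simp: hom_mult)
  qed
  moreover have "mop M \<omega> ?bs \<in> hom ?H (grp M (opn A \<omega> ?bs))"
    using App A M as by (intro module_mop_hom[where n = "length ts"] teval_map_tuples[where n = n]) auto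
  ultimately have "mop M \<omega> ?bs \<circ> ?f \<in> hom ?G (grp M (opn A \<omega> ?bs))"
    by (rule hom_compose)
  then show ?case by (simp add: comp_def hom_def Pi_iff)
qed

section \<open>Total algebras and membership in the variety\<close>

lemma total_algebra_simps [simp]:
  "car (total_algebra A P) = Sigma (car A) (fib P)"
  "opn (total_algebra A P) \<omega> xs = (opn A \<omega> (map fst xs), pop P \<omega> (map fst xs) (map snd xs))"
  by (simp_all add: total_algebra_def)

lemma teval_total_algebra:
  assumes "t \<in> terms \<Omega> n" "length xs = n"
  shows "teval (total_algebra A P) t xs =
    (teval A t (map fst xs), oeval A P t (map fst xs) (map snd xs))"
  using assms(1)
proof induction
  case (Var i)
  then show ?case using assms(2) by simp
next
  case (App \<omega> ts)
  then show ?case by (simp add: comp_def cong: map_cong)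
qed

lemma tuples_total_algebra_iff:
  "xs \<in> tuples (total_algebra A P) n \<longleftrightarrow>
     map fst xs \<in> tuples A n \<and> map snd xs \<in> fibs P (map fst xs)"
proof -
  have "x \<in> Sigma B C \<longleftrightarrow> fst x \<in> B \<and> snd x \<in> C (fst x)" for x :: "'a \<times> 'b" and B C
    by (cases x) simp
  then show ?thesis
    by (auto simp: tuples_iff fibs_iff)
qed

text \<open>Terms evaluate in the total algebra to pairs. For an identity in \<open>E\<close> the
  first coordinates agree because \<open>A\<close> lies in the variety, so only the second
  coordinates remain, and these are the term maps of \<open>P\<close>. This reduces part (2) of the
  theorem to part (1).\<close>

lemma totally_in_iff:
  assumes A: "is_algebra \<Omega> A" and P: "is_pointed_overalgebra \<Omega> A P"
    and E: "E \<subseteq> identities \<Omega>" and AE: "in_variety \<Omega> E A"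
  shows "totally_in \<Omega> E A P \<longleftrightarrow> (\<forall>e\<in>E. satisfies A P e)"
proof -
  let ?T = "total_algebra A P"
  have "is_algebra \<Omega> ?T"
    unfolding is_algebra_def
  proof (intro allI ballI)
    fix n \<omega> xs assume "\<omega> \<in> \<Omega> n" "xs \<in> tuples ?T n"
    then show "opn ?T \<omega> xs \<in> car ?T"
      using A P by (auto simp: tuples_total_algebra_iff is_algebra_def
          intro!: pop_closed)
  qed
  moreover have "alg_satisfies ?T e \<longleftrightarrow> satisfies A P e" if "e \<in> E" for e
  proof -
    obtain n t t' where e: "e = (n, t, t')" by (cases e)
    then have t: "t \<in> terms \<Omega> n" "t' \<in> terms \<Omega> n"
      using E that by (auto simp: identities_def)
    have Ae: "alg_satisfies A (n, t, t')"
      using AE that e by (auto simp: in_variety_def)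
    have "alg_satisfies ?T e \<longleftrightarrow> (\<forall>xs\<in>tuples ?T n. teval ?T t xs = teval ?T t' xs)"
      by (simp add: e alg_satisfies_def)
    also have "\<dots> \<longleftrightarrow> (\<forall>xs\<in>tuples ?T n.
        oeval A P t (map fst xs) (map snd xs) = oeval A P t' (map fst xs) (map snd xs))"
    proof (rule ball_cong[OF refl])
      fix xs assume xs: "xs \<in> tuples ?T n"
      then have "length xs = n" "map fst xs \<in> tuples A n"
        by (auto simp: tuples_total_algebra_iff tuples_iff)
      then show "teval ?T t xs = teval ?T t' xs \<longleftrightarrow>
          oeval A P t (map fst xs) (map snd xs) = oeval A P t' (map fst xs) (map snd xs)"
        using Ae t by (simp add: teval_total_algebra alg_satisfies_def)
    qed
    also have "\<dots> \<longleftrightarrow> (\<forall>as\<in>tuples A n. \<forall>ps\<in>fibs P as. oeval A P t as ps = oeval A P t' as ps)"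
    proof (intro iffI ballI)
      fix as ps
      assume *: "\<forall>xs\<in>tuples ?T n.
          oeval A P t (map fst xs) (map snd xs) = oeval A P t' (map fst xs) (map snd xs)"
        and as: "as \<in> tuples A n" and ps: "ps \<in> fibs P as"
      then have "length as = length ps" by (simp add: fibs_iff)
      \<comment> \<open>A pair of tuples \<open>as\<close> and \<open>ps\<close> of equal length
        comes from the tuple of pairs \<open>zip as ps\<close> in the total algebra.\<close>
      then show "oeval A P t as ps = oeval A P t' as ps"
        using *[rule_format, of "zip as ps"] as ps by (simp add: tuples_total_algebra_iff)
    qed (simp add: tuples_total_algebra_iff)
    finally show ?thesis
      using Ae by (simp add: e satisfies_def)
  qed
  ultimately show ?thesis
    by (simp add: totally_in_def in_variety_def)
qed


section \<open>Quotients and free modules\<close>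

abbreviation coset_map :: "('f, 'a, 'm) amodule \<Rightarrow> ('a \<Rightarrow> 'm set) \<Rightarrow> 'a \<Rightarrow> 'm \<Rightarrow> 'm set" where
  "coset_map M K \<equiv> \<lambda>a x. K a #>\<^bsub>grp M a\<^esub> x"

lemma grp_quotient_module [simp]: "grp (quotient_module A M K) a = grp M a Mod K a"
  by (simp add: quotient_module_def)

lemma submodule_normal:
  assumes "is_module \<Omega> A M" "is_submodule \<Omega> A M K" "a \<in> car A"
  shows "K a \<lhd> grp M a"
  using assms by (auto simp: is_module_def is_submodule_def comm_group.subgroup_imp_normal)

text \<open>Two tuples of representatives differ by a tuple from \<open>K\<close>. The operation is
  a homomorphism and \<open>K\<close> is closed under it, so the results differ by an element of
  \<open>K\<close>, and the union defining the quotient operation runs over copies of one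
  coset.\<close>

lemma mop_quotient_module:
  assumes A: "is_algebra \<Omega> A" and M: "is_module \<Omega> A M" and K: "is_submodule \<Omega> A M K"
    and \<omega>: "\<omega> \<in> \<Omega> n" and as: "as \<in> tuples A n"
    and xs: "xs \<in> carrier (product_group_list (map (grp M) as))"
  shows "mop (quotient_module A M K) \<omega> as (map2 (coset_map M K) as xs) =
    coset_map M K (opn A \<omega> as) (mop M \<omega> as xs)"
proof -
  let ?b = "opn A \<omega> as" and ?cs = "map2 (coset_map M K) as xs"
  let ?G = "product_group_list (map (grp M) as)"
  note hom = module_mop_hom[OF M \<omega> as]
  have b: "?b \<in> car A"
    using A \<omega> as by (simp add: is_algebra_def)
  have len: "length xs = length as" and mem: "\<And>i. i < length as \<Longrightarrow> xs ! i \<in> carrier (grp M (as ! i))"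
    using xs by (auto simp: carrier_product_group_list_iff)
  have sub: "subgroup (K a) (grp M a)" if "a \<in> car A" for a
    using K that by (simp add: is_submodule_def)
  have as_mem: "as ! i \<in> car A" if "i < length as" for i
    using as that by (simp add: tuples_iff)
  have "coset_map M K ?b (mop M \<omega> as ms) = coset_map M K ?b (mop M \<omega> as xs)"
    if ms: "ms \<in> listset ?cs" for ms
  proof -
    \<comment> \<open>The entry \<open>ms ! i\<close> lies in the coset of \<open>xs ! i\<close>,
      which gives the difference \<open>k i\<close> in \<open>K\<close>.\<close>
    have "\<forall>i<length as. \<exists>k\<in>K (as ! i). ms ! i = k \<otimes>\<^bsub>grp M (as ! i)\<^esub> xs ! i"
      using ms len by (auto simp: listset_iff r_coset_def)
    then obtain k where k: "\<And>i. i < length as \<Longrightarrow> k i \<in> K (as ! i)"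
        "\<And>i. i < length as \<Longrightarrow> ms ! i = k i \<otimes>\<^bsub>grp M (as ! i)\<^esub> xs ! i"
      by metis
    let ?ks = "map k [0..<length as]"
    have ks: "?ks \<in> listset (map K as)"
      using k by (simp add: listset_iff)
    have ksG: "?ks \<in> carrier ?G"
      using k sub as_mem subgroup.mem_carrier by (fastforce simp: carrier_product_group_list_iff)
    have "ms = ?ks \<otimes>\<^bsub>?G\<^esub> xs"
      using k ms len by (intro nth_equalityI) (auto simp: listset_iff)
    then have "mop M \<omega> as ms = mop M \<omega> as ?ks \<otimes>\<^bsub>grp M ?b\<^esub> mop M \<omega> as xs"
      using hom_mult[OF hom ksG xs] by simp
    moreover have "mop M \<omega> as ?ks \<in> K ?b"
      using K \<omega> as ks unfolding is_submodule_def by blast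
    ultimately have "mop M \<omega> as ms \<in> K ?b #>\<^bsub>grp M ?b\<^esub> mop M \<omega> as xs"
      by (auto simp: r_coset_def)
    then show ?thesis
      using group.repr_independence[OF module_group[OF M b] _ hom_in_carrier[OF hom xs] sub[OF b]]
      by simp
  qed
  \<comment> \<open>At least one choice of representatives exists, namely \<open>xs\<close>; an
    empty union would be the empty set and not a coset.\<close>
  moreover have "listset ?cs \<noteq> {}"
  proof -
    have "xs ! i \<in> coset_map M K (as ! i) (xs ! i)" if "i < length as" for i
      using group.rcos_self[OF module_group[OF M] mem sub] as_mem that by simp
    then have "xs \<in> listset ?cs"
      using len by (simp add: listset_iff)
    then show ?thesis by blast
  qed
  ultimately show ?thesis
    by (simp add: quotient_module_def SUP_eq_const)
qed

text \<open>Representatives can be chosen in all places at once, so a claim about tuples of cosets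
  reduces to tuples of \<open>M\<close>.\<close>

lemma carrier_quotient_product:
  "carrier (product_group_list (map (grp (quotient_module A M K)) as)) =
     map2 (coset_map M K) as ` carrier (product_group_list (map (grp M) as))" (is "?L = ?R")
proof
  show "?R \<subseteq> ?L"
    by (auto simp: carrier_product_group_list_iff carrier_FactGroup)
  show "?L \<subseteq> ?R"
  proof
    fix cs assume cs: "cs \<in> ?L"
    then have "\<forall>i<length as. \<exists>x\<in>carrier (grp M (as ! i)). cs ! i = coset_map M K (as ! i) x"
      by (auto simp: carrier_product_group_list_iff carrier_FactGroup)
    then obtain x where x: "\<And>i. i < length as \<Longrightarrow> x i \<in> carrier (grp M (as ! i))"
        "\<And>i. i < length as \<Longrightarrow> cs ! i = coset_map M K (as ! i) (x i)"
      by metis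
    then have "map x [0..<length as] \<in> carrier (product_group_list (map (grp M) as))"
      by (simp add: carrier_product_group_list_iff)
    moreover have "cs = map2 (coset_map M K) as (map x [0..<length as])"
      using cs x by (intro nth_equalityI) (auto simp: carrier_product_group_list_iff)
    ultimately show "cs \<in> ?R" by blast
  qed
qed

lemma is_module_quotient_module:
  assumes A: "is_algebra \<Omega> A" and M: "is_module \<Omega> A M" and K: "is_submodule \<Omega> A M K"
  shows "is_module \<Omega> A (quotient_module A M K)" (is "is_module _ _ ?Q")
  unfolding is_module_def
proof (intro conjI allI ballI)
  fix a assume "a \<in> car A"
  then show "comm_group (grp ?Q a)"
    using M K by (simp add: is_module_def is_submodule_def comm_group.abelian_FactGroup)
next
  fix n \<omega> as assume \<omega>: "\<omega> \<in> \<Omega> n" and as: "as \<in> tuples A n"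
  let ?b = "opn A \<omega> as" and ?G = "product_group_list (map (grp M) as)"
  let ?H = "product_group_list (map (grp ?Q) as)"
  note hom = module_mop_hom[OF M \<omega> as] and mop = mop_quotient_module[OF A M K \<omega> as]
  have b: "?b \<in> car A"
    using A \<omega> as by (simp add: is_algebra_def)
  note bhom = normal.r_coset_hom_Mod[OF submodule_normal[OF M K b]]
  have as_mem: "as ! i \<in> car A" if "i < length as" for i
    using as that by (simp add: tuples_iff)
  have grp: "group ?G"
    using as_mem by (intro group_product_group_list) (simp add: module_group[OF M])
  show "mop ?Q \<omega> as \<in> hom ?H (grp ?Q ?b)"
  proof (rule homI)
    fix cs assume "cs \<in> carrier ?H"
    then obtain xs where xs: "xs \<in> carrier ?G" "cs = map2 (coset_map M K) as xs"
      unfolding carrier_quotient_product by blast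
    then show "mop ?Q \<omega> as cs \<in> carrier (grp ?Q ?b)"
      using mop hom_in_carrier[OF hom] by (auto simp: carrier_FactGroup)
  next
    fix cs ds assume "cs \<in> carrier ?H" "ds \<in> carrier ?H"
    then obtain xs ys where xs: "xs \<in> carrier ?G" "cs = map2 (coset_map M K) as xs"
      and ys: "ys \<in> carrier ?G" "ds = map2 (coset_map M K) as ys"
      unfolding carrier_quotient_product by blast
    \<comment> \<open>Tuples of cosets multiply by multiplying representatives, since each
      \<open>K a\<close> is normal. With \<open>mop_quotient_module\<close> the homomorphism law is
      inherited from \<open>M\<close>.\<close>
    have "cs \<otimes>\<^bsub>?H\<^esub> ds = map2 (coset_map M K) as (xs \<otimes>\<^bsub>?G\<^esub> ys)"
      using xs ys as_mem
      by (intro nth_equalityI) (auto simp: carrier_product_group_list_iff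
          normal.rcos_sum[OF submodule_normal[OF M K]])
    then show "mop ?Q \<omega> as (cs \<otimes>\<^bsub>?H\<^esub> ds) = mop ?Q \<omega> as cs \<otimes>\<^bsub>grp ?Q ?b\<^esub> mop ?Q \<omega> as ds"
      using xs ys mop grp hom_mult[OF bhom hom_in_carrier[OF hom] hom_in_carrier[OF hom]]
      by (simp add: hom_mult[OF hom] group.is_monoid monoid.m_closed)
  qed
qed

lemma is_submodule_carrier:
  assumes A: "is_algebra \<Omega> A" and M: "is_module \<Omega> A M"
  shows "is_submodule \<Omega> A M (\<lambda>a. carrier (grp M a))"
  unfolding is_submodule_def
proof (intro conjI allI ballI)
  fix n \<omega> as ms
  assume *: "\<omega> \<in> \<Omega> n" "as \<in> tuples A n" "ms \<in> listset (map (\<lambda>a. carrier (grp M a)) as)"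
  then have "ms \<in> carrier (product_group_list (map (grp M) as))"
    by (simp add: product_group_list_def comp_def)
  then show "mop M \<omega> as ms \<in> carrier (grp M (opn A \<omega> as))"
    by (rule hom_in_carrier[OF module_mop_hom[OF M *(1,2)]])
qed (simp add: group.subgroup_self module_group[OF M])

section \<open>The free modulization and its generators\<close>

lemma grp_free_modulization [simp]: "grp (free_modulization P) a = free_Abelian_group (fib P a)"
  by (simp add: free_modulization_def)

lemma mop_free_modulization [simp]:
  "mop (free_modulization P) \<omega> as ms = (\<Sum>i<length as. free_op_at P \<omega> as i (ms ! i))"
  by (simp add: free_modulization_def)

lemma pts_update_in_fibs:
  assumes "is_pointed_overalgebra \<Omega> A P" "as \<in> tuples A n" "i < n" "p \<in> fib P (as ! i)"
  shows "(map (pt P) as)[i := p] \<in> fibs P as"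
  using assms by (auto simp: fibs_iff tuples_iff is_pointed_overalgebra_def nth_list_update)

lemma is_module_free_modulization:
  assumes A: "is_algebra \<Omega> A" and P: "is_pointed_overalgebra \<Omega> A P"
  shows "is_module \<Omega> A (free_modulization P)" (is "is_module _ _ ?F")
  unfolding is_module_def
proof (intro conjI allI ballI)
  fix n \<omega> as assume \<omega>: "\<omega> \<in> \<Omega> n" and as: "as \<in> tuples A n"
  let ?b = "opn A \<omega> as" and ?G = "product_group_list (map (grp ?F) as)"
  show "mop ?F \<omega> as \<in> hom ?G (grp ?F ?b)"
  proof (rule homI)
    fix xs assume xs: "xs \<in> carrier ?G"
    have "free_op_at P \<omega> as i (xs ! i) \<in> carrier (free_Abelian_group (fib P ?b))"
      if i: "i < length as" for i
    proof -
      have "Poly_Mapping.keys (xs ! i) \<subseteq> fib P (as ! i)"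
        using xs i by (auto simp: carrier_product_group_list_iff)
      moreover have "pop P \<omega> as ((map (pt P) as)[i := p]) \<in> fib P ?b" if "p \<in> fib P (as ! i)" for p
        using pop_closed[OF P \<omega> as] pts_update_in_fibs[OF P as] as i that by (simp add: tuples_iff)
      ultimately show ?thesis
        \<comment> \<open>The support of the image is contained in the union of the supports of the
          images of the generators involved, and each of those generators is sent to a generator
          from the right fiber.\<close>
        unfolding free_op_at_def carrier_free_Abelian_group_iff
        by (intro order_trans[OF keys_frag_extend]) auto
    qed
    then show "mop ?F \<omega> as xs \<in> carrier (grp ?F ?b)"
      unfolding mop_free_modulization grp_free_modulization
      by (intro sum_closed_free_Abelian_group) simp
  next
    fix xs ys assume "xs \<in> carrier ?G" "ys \<in> carrier ?G"
    show "mop ?F \<omega> as (xs \<otimes>\<^bsub>?G\<^esub> ys) = mop ?F \<omega> as xs \<otimes>\<^bsub>grp ?F ?b\<^esub> mop ?F \<omega> as ys"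
      by (simp add: free_op_at_def frag_extend_add sum.distrib)
  qed
qed (simp add: abelian_free_Abelian_group)

text \<open>All summands other than the \<open>i\<close>-th vanish, since \<open>frag_extend\<close>
  sends 0 to 0. On such a tuple the free operation therefore agrees with the operation of
  \<open>P\<close> on base points and \<open>p\<close>, even before relators are divided
  out.\<close>

lemma mop_free_modulization_generator:
  assumes "i < length as"
  shows "mop (free_modulization P) \<omega> as ((map (\<lambda>a. 0) as)[i := frag_of p]) =
    frag_of (pop P \<omega> as ((map (pt P) as)[i := p]))"
proof -
  have "mop (free_modulization P) \<omega> as ((map (\<lambda>a. 0) as)[i := frag_of p]) =
      (\<Sum>j<length as. if j = i then frag_of (pop P \<omega> as ((map (pt P) as)[i := p])) else 0)"
    unfolding mop_free_modulization
    using assms by (intro sum.cong) (auto simp: free_op_at_def nth_list_update)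
  then show ?thesis
    using assms by simp
qed

text \<open>The generated subgroup contains the generators and is closed under differences, which is
  what \<open>free_Abelian_group_induct\<close> asks for. The result supplies generating sets for
  \<open>product_group_list_hom_eqI\<close>.\<close>

lemma generate_free_Abelian_group:
  "generate (free_Abelian_group S) (frag_of ` S) = carrier (free_Abelian_group S)"
proof
  interpret group "free_Abelian_group S" by simp
  have sub: "frag_of ` S \<subseteq> carrier (free_Abelian_group S)"
    by (auto simp: keys_frag_of)
  then show "generate (free_Abelian_group S) (frag_of ` S) \<subseteq> carrier (free_Abelian_group S)"
    by (rule generate_incl)
  show "carrier (free_Abelian_group S) \<subseteq> generate (free_Abelian_group S) (frag_of ` S)"
  proof
    fix x assume "x \<in> carrier (free_Abelian_group S)"
    then have "Poly_Mapping.keys x \<subseteq> S" by simp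
    then show "x \<in> generate (free_Abelian_group S) (frag_of ` S)"
    proof (rule free_Abelian_group_induct)
      show "0 \<in> generate (free_Abelian_group S) (frag_of ` S)"
        using generate.one[of "free_Abelian_group S"] by simp
    next
      fix x y :: "'a \<Rightarrow>\<^sub>0 int"
      assume xy: "Poly_Mapping.keys x \<subseteq> S" "Poly_Mapping.keys y \<subseteq> S"
        "x \<in> generate (free_Abelian_group S) (frag_of ` S)"
        "y \<in> generate (free_Abelian_group S) (frag_of ` S)"
      then have "x \<otimes>\<^bsub>free_Abelian_group S\<^esub> inv\<^bsub>free_Abelian_group S\<^esub> y \<in>
          generate (free_Abelian_group S) (frag_of ` S)"
        using generate.eng[OF _ generate_m_inv_closed[OF sub]] by blast
      then show "x - y \<in> generate (free_Abelian_group S) (frag_of ` S)"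
        using xy by simp
    qed (simp add: generate.incl)
  qed
qed


section \<open>The modulization\<close>

lemma mop_free_modulization_generators:
  assumes "length ps = length as"
  shows "mop (free_modulization P) \<omega> as (map frag_of ps) =
    (\<Sum>i<length as. free_op_at P \<omega> as i (frag_of (ps ! i)))"
  using assms by simp

text \<open>With \<open>is_submodule_carrier\<close>, this exhibits one member of the family whose
  intersection is the modulization kernel.\<close>

lemma contains_relators_carrier:
  assumes A: "is_algebra \<Omega> A" and P: "is_pointed_overalgebra \<Omega> A P"
  shows "contains_relators \<Omega> A P (\<lambda>a. carrier (grp (free_modulization P) a))"
  unfolding contains_relators_def
proof (intro conjI allI ballI)
  fix a assume "a \<in> car A"
  then show "frag_of (pt P a) \<in> carrier (grp (free_modulization P) a)"
    using P by (simp add: is_pointed_overalgebra_def keys_frag_of)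
next
  fix n \<omega> as ps assume \<omega>: "\<omega> \<in> \<Omega> n" and as: "as \<in> tuples A n" and ps: "ps \<in> fibs P as"
  let ?b = "opn A \<omega> as"
  have len: "length ps = length as" "length as = n"
    using as ps by (auto simp: tuples_iff fibs_iff)
  have "map frag_of ps \<in> carrier (product_group_list (map (grp (free_modulization P)) as))"
    using ps by (auto simp: carrier_product_group_list_iff fibs_iff keys_frag_of)
  then have "mop (free_modulization P) \<omega> as (map frag_of ps) \<in> carrier (free_Abelian_group (fib P ?b))"
    using hom_in_carrier[OF module_mop_hom[OF is_module_free_modulization[OF A P] \<omega> as]] by simp
  moreover have "frag_of (pop P \<omega> as ps) \<in> carrier (free_Abelian_group (fib P ?b))"
    using pop_closed[OF P \<omega> as ps] by simp
  ultimately show "frag_of (pop P \<omega> as ps) - (\<Sum>i<n. free_op_at P \<omega> as i (frag_of (ps ! i)))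
      \<in> carrier (grp (free_modulization P) ?b)"
    \<comment> \<open>The sum in the relator is the free operation applied to the tuple of
      generators, so the relator is a difference of two elements of the free group.\<close>
    unfolding mop_free_modulization_generators[OF len(1)] len(2) grp_free_modulization
      carrier_free_Abelian_group_iff
    by (meson keys_diff le_sup_iff order_trans)
qed

lemma modulization_kernel_least:
  assumes "is_submodule \<Omega> A (free_modulization P) S" "contains_relators \<Omega> A P S"
  shows "modulization_kernel \<Omega> A P a \<subseteq> S a"
  using assms by (auto simp: modulization_kernel_def)

lemma contains_relators_modulization_kernel:
  "contains_relators \<Omega> A P (modulization_kernel \<Omega> A P)"
  by (auto simp: contains_relators_def modulization_kernel_def)

lemma is_submodule_modulization_kernel:
  assumes A: "is_algebra \<Omega> A" and P: "is_pointed_overalgebra \<Omega> A P"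
  shows "is_submodule \<Omega> A (free_modulization P) (modulization_kernel \<Omega> A P)"
  unfolding is_submodule_def
proof (intro conjI allI ballI)
  let ?F = "free_modulization P"
  fix a assume a: "a \<in> car A"
  note F = is_module_free_modulization[OF A P]
  show "subgroup (modulization_kernel \<Omega> A P a) (grp ?F a)"
    unfolding modulization_kernel_def
  proof (rule group.subgroups_Inter)
    show "group (grp ?F a)" by simp
    \<comment> \<open>The intersection of an empty family would be the whole type, which need not be
      contained in the fiber.\<close>
    show "{S a |S. is_submodule \<Omega> A ?F S \<and> contains_relators \<Omega> A P S} \<noteq> {}"
      using is_submodule_carrier[OF A F] contains_relators_carrier[OF A P] by blast
  qed (use a in \<open>auto simp: is_submodule_def\<close>)
next
  let ?F = "free_modulization P"
  fix n \<omega> as ms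
  assume \<omega>: "\<omega> \<in> \<Omega> n" and as: "as \<in> tuples A n"
    and ms: "ms \<in> listset (map (modulization_kernel \<Omega> A P) as)"
  have "mop ?F \<omega> as ms \<in> S (opn A \<omega> as)"
    if S: "is_submodule \<Omega> A ?F S" "contains_relators \<Omega> A P S" for S
  proof -
    have "ms \<in> listset (map S as)"
      using ms modulization_kernel_least[OF S] by (auto simp: listset_iff)
    then show ?thesis
      using S(1) \<omega> as unfolding is_submodule_def by blast
  qed
  then show "mop ?F \<omega> as ms \<in> modulization_kernel \<Omega> A P (opn A \<omega> as)"
    unfolding modulization_kernel_def by blast
qed

section \<open>The modulization as a module, its unit and its generators\<close>

lemma is_module_modulization:
  assumes "is_algebra \<Omega> A" "is_pointed_overalgebra \<Omega> A P"
  shows "is_module \<Omega> A (modulization \<Omega> A P)"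
  unfolding modulization_def using assms
  by (intro is_module_quotient_module is_module_free_modulization is_submodule_modulization_kernel)

lemma grp_modulization:
  "grp (modulization \<Omega> A P) a = free_Abelian_group (fib P a) Mod modulization_kernel \<Omega> A P a"
  by (simp add: modulization_def)

lemma modulization_coset_hom:
  assumes "is_algebra \<Omega> A" "is_pointed_overalgebra \<Omega> A P" "a \<in> car A"
  shows "coset_map (free_modulization P) (modulization_kernel \<Omega> A P) a \<in>
    hom (free_Abelian_group (fib P a)) (grp (modulization \<Omega> A P) a)"
  using normal.r_coset_hom_Mod[OF submodule_normal[OF is_module_free_modulization[OF assms(1,2)]
      is_submodule_modulization_kernel[OF assms(1,2)] assms(3)]]
  by (simp add: grp_modulization)

lemma modulization_unit_eq:
  assumes "a \<in> car A" "p \<in> fib P a"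
  shows "modulization_unit \<Omega> A P a p =
    coset_map (free_modulization P) (modulization_kernel \<Omega> A P) a (frag_of p)"
  using assms by (simp add: modulization_unit_def)

lemma modulization_unit_in_carrier:
  assumes "a \<in> car A" "p \<in> fib P a"
  shows "modulization_unit \<Omega> A P a p \<in> carrier (grp (modulization \<Omega> A P) a)"
  using assms by (auto simp: modulization_unit_eq grp_modulization carrier_FactGroup keys_frag_of)

text \<open>Both conditions hold because relators lie in the kernel: the generator of a base point
  becomes neutral, and the generator of an operation value in \<open>P\<close> lies in the coset of
  the free operation on the generators.\<close>

lemma modulization_unit_hom:
  assumes A: "is_algebra \<Omega> A" and P: "is_pointed_overalgebra \<Omega> A P"
  shows "modulization_unit \<Omega> A P \<in> pointed_hom \<Omega> A P (forget (modulization \<Omega> A P))"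
proof -
  let ?F = "free_modulization P" and ?K = "modulization_kernel \<Omega> A P"
  let ?N = "modulization \<Omega> A P" and ?\<eta> = "modulization_unit \<Omega> A P"
  note F = is_module_free_modulization[OF A P] and K = is_submodule_modulization_kernel[OF A P]
  note rel = contains_relators_modulization_kernel[of \<Omega> A P, unfolded contains_relators_def]
  have sub: "subgroup (?K a) (free_Abelian_group (fib P a))" if "a \<in> car A" for a
    using K that by (simp add: is_submodule_def)
  have "?\<eta> a (pt P a) = \<one>\<^bsub>grp ?N a\<^esub>" if a: "a \<in> car A" for a
  proof -
    have "pt P a \<in> fib P a" "frag_of (pt P a) \<in> ?K a"
      using P rel a by (auto simp: is_pointed_overalgebra_def)
    then show ?thesis
      using a group.coset_join2[OF group_free_Abelian_group _ sub[OF a]]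
      by (simp add: modulization_unit_eq grp_modulization)
  qed
  then have "?\<eta> \<in> (\<Pi>\<^sub>E a\<in>car A.
      {f \<in> fib P a \<rightarrow>\<^sub>E fib (forget ?N) a. f (pt P a) = pt (forget ?N) a})"
    by (auto simp: modulization_unit_in_carrier) (auto simp: modulization_unit_def)
  moreover have "?\<eta> (opn A \<omega> as) (pop P \<omega> as ps) = mop ?N \<omega> as (map2 ?\<eta> as ps)"
    if \<omega>: "\<omega> \<in> \<Omega> n" and as: "as \<in> tuples A n" and ps: "ps \<in> fibs P as" for n \<omega> as ps
  proof -
    let ?b = "opn A \<omega> as" and ?G = "product_group_list (map (grp ?F) as)"
    let ?x = "mop ?F \<omega> as (map frag_of ps)"
    have b: "?b \<in> car A"
      using A \<omega> as by (simp add: is_algebra_def)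
    have len: "length ps = length as" "length as = n"
      using as ps by (auto simp: tuples_iff fibs_iff)
    have frags: "map frag_of ps \<in> carrier ?G"
      using ps by (auto simp: carrier_product_group_list_iff fibs_iff keys_frag_of)
    have x: "?x \<in> carrier (free_Abelian_group (fib P ?b))"
      using hom_in_carrier[OF module_mop_hom[OF F \<omega> as] frags] by simp
    have "map2 ?\<eta> as ps = map2 (coset_map ?F ?K) as (map frag_of ps)"
      using as ps by (intro nth_equalityI) (auto simp: tuples_iff fibs_iff modulization_unit_eq)
    then have "mop ?N \<omega> as (map2 ?\<eta> as ps) = coset_map ?F ?K ?b ?x"
      unfolding modulization_def using mop_quotient_module[OF A F K \<omega> as frags] by simp
    moreover have "frag_of (pop P \<omega> as ps) - ?x \<in> ?K ?b"
      using rel \<omega> as ps unfolding mop_free_modulization_generators[OF len(1)] len(2) by blast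
    \<comment> \<open>Membership of the difference in the kernel puts the generator into the coset
      of \<open>?x\<close>; cosets with a common element coincide.\<close>
    then have "frag_of (pop P \<omega> as ps) \<in> coset_map ?F ?K ?b ?x"
      by (force simp: r_coset_def simp del: mop_free_modulization)
    then have "coset_map ?F ?K ?b ?x = coset_map ?F ?K ?b (frag_of (pop P \<omega> as ps))"
      using group.repr_independence[OF group_free_Abelian_group _ x sub[OF b]] by simp
    ultimately show ?thesis
      using b pop_closed[OF P \<omega> as ps] by (simp add: modulization_unit_eq)
  qed
  ultimately show ?thesis
    by (auto simp: pointed_hom_def)
qed

text \<open>The coset map is a homomorphism onto the quotient fiber that takes the free generators
  to the values of the unit, and homomorphisms carry generated subgroups to generated
  subgroups.\<close>

lemma generate_modulization:
  assumes A: "is_algebra \<Omega> A" and P: "is_pointed_overalgebra \<Omega> A P" and a: "a \<in> car A"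
  shows "generate (grp (modulization \<Omega> A P) a) (modulization_unit \<Omega> A P a ` fib P a) =
    carrier (grp (modulization \<Omega> A P) a)"
proof -
  let ?F = "free_modulization P" and ?K = "modulization_kernel \<Omega> A P"
  let ?G = "free_Abelian_group (fib P a)" and ?H = "grp (modulization \<Omega> A P) a"
  interpret group_hom ?G ?H "coset_map ?F ?K a"
    using modulization_coset_hom[OF A P a] module_group[OF is_module_modulization[OF A P] a]
    by (simp add: group_hom_def group_hom_axioms_def)
  have "modulization_unit \<Omega> A P a ` fib P a = coset_map ?F ?K a ` (frag_of ` fib P a)"
    using a by (simp add: modulization_unit_eq image_image)
  moreover have "frag_of ` fib P a \<subseteq> carrier ?G"
    by (auto simp: keys_frag_of)
  ultimately have "generate ?H (modulization_unit \<Omega> A P a ` fib P a) =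
      coset_map ?F ?K a ` carrier ?G"
    using generate_img generate_free_Abelian_group by metis
  then show ?thesis
    by (simp add: grp_modulization carrier_FactGroup)
qed

section \<open>Transfer of identities from \<open>P\<close> to the modulization\<close>

lemma pointed_hom_pts_update:
  assumes "\<phi> \<in> pointed_hom \<Omega> A P Q" "as \<in> tuples A n" "i < n"
  shows "map2 \<phi> as ((map (pt P) as)[i := p]) = (map (pt Q) as)[i := \<phi> (as ! i) p]"
proof -
  have "\<phi> a (pt P a) = pt Q a" if "a \<in> car A" for a
    using assms(1) that by (auto simp: pointed_hom_def PiE_iff)
  then show ?thesis
    using assms(2,3) by (intro nth_equalityI) (auto simp: tuples_iff nth_list_update)
qed

text \<open>The term maps are compared on generators, and the unit supplies generators at which the
  equation can be pulled back to \<open>P\<close>.\<close>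

lemma satisfies_modulization:
  assumes A: "is_algebra \<Omega> A" and P: "is_pointed_overalgebra \<Omega> A P"
    and e: "e \<in> identities \<Omega>" and sat: "satisfies A P e"
  shows "satisfies A (forget (modulization \<Omega> A P)) e"
proof -
  obtain n t t' where "e = (n, t, t')" by (cases e)
  with e sat have e: "e = (n, t, t')" and t: "t \<in> terms \<Omega> n" "t' \<in> terms \<Omega> n"
    and Ae: "alg_satisfies A (n, t, t')"
    and eq: "\<And>as ps. as \<in> tuples A n \<Longrightarrow> ps \<in> fibs P as \<Longrightarrow> oeval A P t as ps = oeval A P t' as ps"
    by (auto simp: identities_def satisfies_def)
  let ?N = "modulization \<Omega> A P" and ?\<eta> = "modulization_unit \<Omega> A P"
  note N = is_module_modulization[OF A P] and \<eta> = modulization_unit_hom[OF A P]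
  have "oeval A (forget ?N) t as ms = oeval A (forget ?N) t' as ms"
    if as: "as \<in> tuples A n" and ms: "ms \<in> fibs (forget ?N) as" for as ms
  proof (rule product_group_list_hom_eqI[where S = "\<lambda>i. ?\<eta> (as ! i) ` fib P (as ! i)"])
    \<comment> \<open>The two term maps end in the fibers over \<open>teval A t as\<close> and
      \<open>teval A t' as\<close>. These fibers have to coincide before the maps can be compared as
      homomorphisms into one group.\<close>
    have teq: "teval A t as = teval A t' as"
      using Ae as by (simp add: alg_satisfies_def)
    show "oeval A (forget ?N) t as \<in>
        hom (product_group_list (map (grp ?N) as)) (grp ?N (teval A t as))"
      by (rule oeval_hom[OF A N t(1) as])
    show "oeval A (forget ?N) t' as \<in>
        hom (product_group_list (map (grp ?N) as)) (grp ?N (teval A t as))"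
      unfolding teq by (rule oeval_hom[OF A N t(2) as])
    show "group (grp ?N (teval A t as))"
      by (rule module_group[OF N teval_closed[OF A t(1) as]])
    show "ms \<in> carrier (product_group_list (map (grp ?N) as))"
      using ms by (simp add: fibs_forget)
    fix i assume "i < length (map (grp ?N) as)"
    then have i: "i < length as" "i < n" "as ! i \<in> car A"
      using as by (auto simp: tuples_iff)
    show "group (map (grp ?N) as ! i)"
      using i module_group[OF N] by simp
    show "?\<eta> (as ! i) ` fib P (as ! i) \<subseteq> carrier (map (grp ?N) as ! i)"
      using i by (auto simp: modulization_unit_in_carrier)
    show "generate (map (grp ?N) as ! i) (?\<eta> (as ! i) ` fib P (as ! i)) =
        carrier (map (grp ?N) as ! i)"
      using i generate_modulization[OF A P] by simp
    fix x assume "x \<in> ?\<eta> (as ! i) ` fib P (as ! i)"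
    then obtain p where p: "p \<in> fib P (as ! i)" and x: "x = ?\<eta> (as ! i) p" by blast
    let ?ps = "(map (pt P) as)[i := p]"
    have ps: "?ps \<in> fibs P as"
      using pts_update_in_fibs[OF P as i(2) p] .
    \<comment> \<open>The unit sends base points to neutral elements, so the test tuple is the image
      of a tuple of \<open>P\<close>, where the identity holds.\<close>
    have "(map one (map (grp ?N) as))[i := x] = map2 ?\<eta> as ?ps"
      using pointed_hom_pts_update[OF \<eta> as i(2)] x by (simp add: comp_def forget_def)
    then show "oeval A (forget ?N) t as ((map one (map (grp ?N) as))[i := x]) =
        oeval A (forget ?N) t' as ((map one (map (grp ?N) as))[i := x])"
      using pointed_hom_oeval[OF A P \<eta> t(1) as ps] pointed_hom_oeval[OF A P \<eta> t(2) as ps]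
        eq[OF as ps] teq by simp
  qed
  then show ?thesis
    using Ae by (simp add: e satisfies_def)
qed

section \<open>The universal property\<close>

lemma free_extension_mop:
  assumes A: "is_algebra \<Omega> A" and P: "is_pointed_overalgebra \<Omega> A P" and M: "is_module \<Omega> A M"
    and \<zeta>: "\<zeta> \<in> pointed_hom \<Omega> A P (forget M)"
    and h: "\<And>a. a \<in> car A \<Longrightarrow> h a \<in> hom (free_Abelian_group (fib P a)) (grp M a)"
    and h\<zeta>: "\<And>a p. a \<in> car A \<Longrightarrow> p \<in> fib P a \<Longrightarrow> h a (frag_of p) = \<zeta> a p"
    and \<omega>: "\<omega> \<in> \<Omega> n" and as: "as \<in> tuples A n"
    and xs: "xs \<in> carrier (product_group_list (map (grp (free_modulization P)) as))"
  shows "h (opn A \<omega> as) (mop (free_modulization P) \<omega> as xs) = mop M \<omega> as (map2 h as xs)"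
proof -
  let ?F = "free_modulization P" and ?b = "opn A \<omega> as"
  let ?G = "product_group_list (map (grp ?F) as)" and ?H = "product_group_list (map (grp M) as)"
  have b: "?b \<in> car A"
    using A \<omega> as by (simp add: is_algebra_def)
  have as_mem: "as ! i \<in> car A" if "i < length as" for i
    using as that by (simp add: tuples_iff)
  have h_one: "h a 0 = \<one>\<^bsub>grp M a\<^esub>" if "a \<in> car A" for a
    using hom_one[OF h[OF that] _ module_group[OF M that]] by simp
  \<comment> \<open>Both sides are homomorphisms from the product of free groups into one fiber of
    \<open>M\<close>, so only tuples with one generator and zeros elsewhere have to be
    checked.\<close>
  have "(h ?b \<circ> mop ?F \<omega> as) xs = (mop M \<omega> as \<circ> map2 h as) xs"
  proof (rule product_group_list_hom_eqI[where S = "\<lambda>i. frag_of ` fib P (as ! i)"])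
    show "h ?b \<circ> mop ?F \<omega> as \<in> hom ?G (grp M ?b)"
      using module_mop_hom[OF is_module_free_modulization[OF A P] \<omega> as] h[OF b]
      by (intro hom_compose) auto
    have "map2 h as \<in> hom ?G ?H"
    proof (rule homI)
      fix ys assume "ys \<in> carrier ?G"
      then show "map2 h as ys \<in> carrier ?H"
        using hom_in_carrier[OF h] as_mem by (auto simp: carrier_product_group_list_iff)
    next
      fix ys zs assume "ys \<in> carrier ?G" "zs \<in> carrier ?G"
      then show "map2 h as (ys \<otimes>\<^bsub>?G\<^esub> zs) = map2 h as ys \<otimes>\<^bsub>?H\<^esub> map2 h as zs"
        using hom_mult[OF h] as_mem
        by (intro nth_equalityI) (auto simp: carrier_product_group_list_iff)
    qed
    then show "mop M \<omega> as \<circ> map2 h as \<in> hom ?G (grp M ?b)"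
      using module_mop_hom[OF M \<omega> as] by (rule hom_compose)
    show "group (grp M ?b)"
      using module_group[OF M b] .
    fix i assume "i < length (map (grp ?F) as)"
    then have i: "i < length as" "i < n" "as ! i \<in> car A"
      using as by (auto simp: tuples_iff)
    show "group (map (grp ?F) as ! i)"
      using i by simp
    show "frag_of ` fib P (as ! i) \<subseteq> carrier (map (grp ?F) as ! i)"
      using i by (auto simp: keys_frag_of)
    show "generate (map (grp ?F) as ! i) (frag_of ` fib P (as ! i)) = carrier (map (grp ?F) as ! i)"
      using i generate_free_Abelian_group by simp
    fix x :: "'c \<Rightarrow>\<^sub>0 int" assume "x \<in> frag_of ` fib P (as ! i)"
    then obtain p where p: "p \<in> fib P (as ! i)" and x: "x = frag_of p" by blast
    let ?ps = "(map (pt P) as)[i := p]" and ?xs = "(map (\<lambda>a. 0) as)[i := x]"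
    have ps: "?ps \<in> fibs P as"
      using pts_update_in_fibs[OF P as i(2) p] .
    \<comment> \<open>On such a tuple the free operation returns a generator, where \<open>h\<close>
      is given by \<open>\<zeta>\<close>.\<close>
    have "h ?b (mop ?F \<omega> as ?xs) = \<zeta> ?b (pop P \<omega> as ?ps)"
      unfolding x mop_free_modulization_generator[OF i(1)]
      by (rule h\<zeta>[OF b pop_closed[OF P \<omega> as ps]])
    also have "\<dots> = mop M \<omega> as (map2 \<zeta> as ?ps)"
      using pointed_hom_pop[OF \<zeta> \<omega> as ps] by simp
    \<comment> \<open>Off place \<open>i\<close> both tuples are neutral, since
      \<open>\<zeta>\<close> preserves base points and \<open>h\<close> sends 0 to the neutral
      element; at \<open>i\<close> both entries are \<open>\<zeta> (as ! i) p\<close>.\<close>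
    also have "map2 \<zeta> as ?ps = map2 h as ?xs"
      using pointed_hom_pts_update[OF \<zeta> as i(2)] i as_mem h_one h\<zeta> p x
      by (intro nth_equalityI) (auto simp: nth_list_update)
    finally show "(h ?b \<circ> mop ?F \<omega> as) ((map one (map (grp ?F) as))[i := x]) =
        (mop M \<omega> as \<circ> map2 h as) ((map one (map (grp ?F) as))[i := x])"
      by (simp add: comp_def del: mop_free_modulization)
  qed (rule xs)
  then show ?thesis
    by (simp del: mop_free_modulization)
qed

text \<open>The kernels of the maps \<open>h a\<close> form a submodule containing the relators, so
  minimality applies. The inclusion is what lets \<open>h\<close> pass to the quotient.\<close>

lemma modulization_kernel_subset_kernel:
  assumes A: "is_algebra \<Omega> A" and P: "is_pointed_overalgebra \<Omega> A P" and M: "is_module \<Omega> A M"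
    and \<zeta>: "\<zeta> \<in> pointed_hom \<Omega> A P (forget M)"
    and h: "\<And>a. a \<in> car A \<Longrightarrow> h a \<in> hom (free_Abelian_group (fib P a)) (grp M a)"
    and h\<zeta>: "\<And>a p. a \<in> car A \<Longrightarrow> p \<in> fib P a \<Longrightarrow> h a (frag_of p) = \<zeta> a p"
  shows "modulization_kernel \<Omega> A P a \<subseteq> kernel (free_Abelian_group (fib P a)) (grp M a) (h a)"
proof (rule modulization_kernel_least)
  let ?F = "free_modulization P"
  let ?S = "\<lambda>a. kernel (free_Abelian_group (fib P a)) (grp M a) (h a)"
  note F = is_module_free_modulization[OF A P]
  have hom: "group_hom (free_Abelian_group (fib P a)) (grp M a) (h a)" if "a \<in> car A" for a
    using h[OF that] module_group[OF M that] by (simp add: group_hom_def group_hom_axioms_def)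
  show "is_submodule \<Omega> A ?F ?S"
    unfolding is_submodule_def
  proof (intro conjI allI ballI)
    fix a assume "a \<in> car A"
    then show "subgroup (?S a) (grp ?F a)"
      using group_hom.subgroup_kernel[OF hom] by simp
  next
    fix n \<omega> as ms
    assume \<omega>: "\<omega> \<in> \<Omega> n" and as: "as \<in> tuples A n" and ms: "ms \<in> listset (map ?S as)"
    have G: "ms \<in> carrier (product_group_list (map (grp ?F) as))"
      using ms by (auto simp: listset_iff kernel_def carrier_product_group_list_iff)
    have "map2 h as ms = map (pt (forget M)) as"
      using ms by (intro nth_equalityI) (auto simp: listset_iff kernel_def)
    then have "h (opn A \<omega> as) (mop ?F \<omega> as ms) = mop M \<omega> as (map (pt (forget M)) as)"
      using free_extension_mop[OF A P M \<zeta> h h\<zeta> \<omega> as G] by simp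
    also have "\<dots> = \<one>\<^bsub>grp M (opn A \<omega> as)\<^esub>"
      using is_pointed_overalgebra_forget[OF A M] \<omega> as
      unfolding is_pointed_overalgebra_def forget_simps by blast
    finally show "mop ?F \<omega> as ms \<in> ?S (opn A \<omega> as)"
      using hom_in_carrier[OF module_mop_hom[OF F \<omega> as] G]
      by (simp add: kernel_def del: mop_free_modulization)
  qed
  show "contains_relators \<Omega> A P ?S"
    unfolding contains_relators_def
  proof (intro conjI allI ballI)
    fix a assume "a \<in> car A"
    then show "frag_of (pt P a) \<in> ?S a"
      using P \<zeta> h\<zeta> by (auto simp: is_pointed_overalgebra_def kernel_def keys_frag_of pointed_hom_def PiE_iff)
  next
    fix n \<omega> as ps assume \<omega>: "\<omega> \<in> \<Omega> n" and as: "as \<in> tuples A n" and ps: "ps \<in> fibs P as"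
    let ?b = "opn A \<omega> as" and ?x = "mop ?F \<omega> as (map frag_of ps)"
    let ?G = "free_Abelian_group (fib P ?b)"
    have len: "length ps = length as" "length as = n"
      using as ps by (auto simp: tuples_iff fibs_iff)
    have b: "?b \<in> car A"
      using A \<omega> as by (simp add: is_algebra_def)
    interpret group_hom ?G "grp M ?b" "h ?b"
      using hom[OF b] .
    have frags: "map frag_of ps \<in> carrier (product_group_list (map (grp ?F) as))"
      using ps by (auto simp: carrier_product_group_list_iff fibs_iff keys_frag_of)
    have x: "?x \<in> carrier ?G"
      using hom_in_carrier[OF module_mop_hom[OF F \<omega> as] frags] by simp
    have p: "frag_of (pop P \<omega> as ps) \<in> carrier ?G"
      using pop_closed[OF P \<omega> as ps] by simp
    have "map2 h as (map frag_of ps) = map2 \<zeta> as ps"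
      using as ps h\<zeta> by (intro nth_equalityI) (auto simp: tuples_iff fibs_iff)
    then have "h ?b ?x = mop M \<omega> as (map2 \<zeta> as ps)"
      using free_extension_mop[OF A P M \<zeta> h h\<zeta> \<omega> as frags] by simp
    also have "\<dots> = h ?b (frag_of (pop P \<omega> as ps))"
      using pointed_hom_pop[OF \<zeta> \<omega> as ps] h\<zeta>[OF b pop_closed[OF P \<omega> as ps]] by simp
    \<comment> \<open>The relator is written as a group product with an inverse so that the
      homomorphism laws of \<open>h ?b\<close> apply; it is turned back into a difference
      afterwards.\<close>
    finally have "h ?b (frag_of (pop P \<omega> as ps) \<otimes>\<^bsub>?G\<^esub> inv\<^bsub>?G\<^esub> ?x) = \<one>\<^bsub>grp M ?b\<^esub>"
      using hom_mult[OF p G.inv_closed[OF x]] hom_inv[OF x] hom_closed[OF x] H.r_inv by metis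
    moreover have "frag_of (pop P \<omega> as ps) \<otimes>\<^bsub>?G\<^esub> inv\<^bsub>?G\<^esub> ?x \<in> carrier ?G"
      using p x by (intro G.m_closed G.inv_closed)
    moreover have "frag_of (pop P \<omega> as ps) \<otimes>\<^bsub>?G\<^esub> inv\<^bsub>?G\<^esub> ?x = frag_of (pop P \<omega> as ps) - ?x"
      using x by (simp del: mop_free_modulization)
    ultimately have "frag_of (pop P \<omega> as ps) - ?x \<in> ?S ?b"
      by (simp add: kernel_def del: mop_free_modulization)
    then show "frag_of (pop P \<omega> as ps) - (\<Sum>i<n. free_op_at P \<omega> as i (frag_of (ps ! i))) \<in> ?S ?b"
      unfolding mop_free_modulization_generators[OF len(1)] len(2) .
  qed
qed

text \<open>The two homomorphisms agree on the values of the unit, which generate each fiber. Off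
  the fibers and off \<open>A\<close> both are \<open>undefined\<close>, so they are equal as
  functions.\<close>

lemma modulization_hom_unique:
  assumes A: "is_algebra \<Omega> A" and P: "is_pointed_overalgebra \<Omega> A P" and M: "is_module \<Omega> A M"
    and \<xi>: "\<xi> \<in> module_hom \<Omega> A (modulization \<Omega> A P) M"
    and \<xi>': "\<xi>' \<in> module_hom \<Omega> A (modulization \<Omega> A P) M"
    and eq: "family_comp A P \<xi> (modulization_unit \<Omega> A P) =
      family_comp A P \<xi>' (modulization_unit \<Omega> A P)"
  shows "\<xi> = \<xi>'"
proof (rule ext)
  fix a
  let ?N = "modulization \<Omega> A P" and ?\<eta> = "modulization_unit \<Omega> A P"
  show "\<xi> a = \<xi>' a"
  proof (cases "a \<in> car A")
    case True
    note hom = \<xi>[unfolded module_hom_def] \<xi>'[unfolded module_hom_def]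
    have \<xi>a: "\<xi> a \<in> hom (grp ?N a) (grp M a)" "\<xi> a \<in> extensional (carrier (grp ?N a))"
      and \<xi>'a: "\<xi>' a \<in> hom (grp ?N a) (grp M a)" "\<xi>' a \<in> extensional (carrier (grp ?N a))"
      using hom True by (auto simp: PiE_iff)
    show ?thesis
    proof (rule extensionalityI[OF \<xi>a(2) \<xi>'a(2)])
      fix y assume y: "y \<in> carrier (grp ?N a)"
      show "\<xi> a y = \<xi>' a y"
      proof (rule group_hom_eq_on_generate[OF _ _ \<xi>a(1) \<xi>'a(1)])
        show "group (grp ?N a)" "group (grp M a)"
          using module_group[OF is_module_modulization[OF A P] True] module_group[OF M True] .
        show "?\<eta> a ` fib P a \<subseteq> carrier (grp ?N a)"
          using True by (auto simp: modulization_unit_in_carrier)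
        show "y \<in> generate (grp ?N a) (?\<eta> a ` fib P a)"
          using y generate_modulization[OF A P True] by simp
        fix x assume "x \<in> ?\<eta> a ` fib P a"
        then obtain p where "p \<in> fib P a" "x = ?\<eta> a p" by blast
        then show "\<xi> a x = \<xi>' a x"
          using fun_cong[OF fun_cong[OF eq], of a p] True by (simp add: family_comp_def compose_def)
      qed
    qed
  next
    case False
    then show ?thesis
      using \<xi> \<xi>' by (auto simp: module_hom_def PiE_iff extensional_def)
  qed
qed

text \<open>In each fiber, \<open>\<zeta>\<close> extends to \<open>h\<close> on the free abelian
  group, and \<open>h\<close> factors through the quotient as \<open>g\<close>. Compatibility of
  \<open>g\<close> with the operations is inherited from \<open>h\<close> by choosing
  representatives.\<close>

lemma modulization_hom_exists:
  assumes A: "is_algebra \<Omega> A" and P: "is_pointed_overalgebra \<Omega> A P" and M: "is_module \<Omega> A M"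
    and \<zeta>: "\<zeta> \<in> pointed_hom \<Omega> A P (forget M)"
  obtains \<xi> where "\<xi> \<in> module_hom \<Omega> A (modulization \<Omega> A P) M"
    and "\<zeta> = family_comp A P \<xi> (modulization_unit \<Omega> A P)"
proof -
  let ?F = "free_modulization P" and ?K = "modulization_kernel \<Omega> A P"
  let ?N = "modulization \<Omega> A P" and ?\<eta> = "modulization_unit \<Omega> A P"
  note F = is_module_free_modulization[OF A P] and K = is_submodule_modulization_kernel[OF A P]
  have "\<exists>h. h \<in> hom (free_Abelian_group (fib P a)) (grp M a) \<and> (\<forall>p\<in>fib P a. h (frag_of p) = \<zeta> a p)"
    if a: "a \<in> car A" for a
  proof -
    interpret comm_group "grp M a"
      using M a by (simp add: is_module_def)
    have "\<zeta> a ` fib P a \<subseteq> carrier (grp M a)"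
      using \<zeta> a by (auto simp: pointed_hom_def PiE_iff)
    then show ?thesis
      by (rule free_Abelian_group_universal) blast
  qed
  then obtain h where h: "\<And>a. a \<in> car A \<Longrightarrow> h a \<in> hom (free_Abelian_group (fib P a)) (grp M a)"
    and h\<zeta>: "\<And>a p. a \<in> car A \<Longrightarrow> p \<in> fib P a \<Longrightarrow> h a (frag_of p) = \<zeta> a p"
    by metis
  have "\<exists>g. g \<in> hom (grp ?N a) (grp M a) \<and>
      (\<forall>x\<in>carrier (free_Abelian_group (fib P a)). g (coset_map ?F ?K a x) = h a x)"
    if a: "a \<in> car A" for a
  proof -
    interpret group_hom "free_Abelian_group (fib P a)" "grp M a" "h a"
      using h[OF a] module_group[OF M a] by (simp add: group_hom_def group_hom_axioms_def)
    have "?K a \<lhd> free_Abelian_group (fib P a)"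
      using submodule_normal[OF F K a] by simp
    then obtain g where "g \<in> hom (free_Abelian_group (fib P a) Mod ?K a) (grp M a)"
        "\<And>x. x \<in> carrier (free_Abelian_group (fib P a)) \<Longrightarrow>
          g (?K a #>\<^bsub>free_Abelian_group (fib P a)\<^esub> x) = h a x"
      using FactGroup_universal_kernel modulization_kernel_subset_kernel[OF A P M \<zeta> h h\<zeta>] by blast
    then show ?thesis
      by (auto simp: grp_modulization)
  qed
  then obtain g where g: "\<And>a. a \<in> car A \<Longrightarrow> g a \<in> hom (grp ?N a) (grp M a)"
    and gh: "\<And>a x. a \<in> car A \<Longrightarrow> x \<in> carrier (free_Abelian_group (fib P a)) \<Longrightarrow>
      g a (coset_map ?F ?K a x) = h a x"
    by metis
  \<comment> \<open>Restriction makes the family \<open>undefined\<close> off its domain, as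
    \<open>module_hom\<close> demands.\<close>
  define \<xi> where "\<xi> = (\<lambda>a\<in>car A. restrict (g a) (carrier (grp ?N a)))"
  have \<xi>g: "\<xi> a c = g a c" if "a \<in> car A" "c \<in> carrier (grp ?N a)" for a c
    using that by (simp add: \<xi>_def)
  have "\<xi> \<in> (\<Pi>\<^sub>E a\<in>car A. hom (grp ?N a) (grp M a) \<inter> extensional (carrier (grp ?N a)))"
  proof (rule PiE_I)
    fix a assume a: "a \<in> car A"
    have "monoid (grp ?N a)"
      using module_group[OF is_module_modulization[OF A P] a] by (rule group.is_monoid)
    then have "\<xi> a \<in> hom (grp ?N a) (grp M a)"
      using g[OF a] \<xi>g[OF a] by (auto simp: hom_def monoid.m_closed)
    then show "\<xi> a \<in> hom (grp ?N a) (grp M a) \<inter> extensional (carrier (grp ?N a))"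
      using a by (simp add: \<xi>_def)
  qed (simp add: \<xi>_def)
  moreover have "\<xi> (opn A \<omega> as) (mop ?N \<omega> as cs) = mop M \<omega> as (map2 \<xi> as cs)"
    if \<omega>: "\<omega> \<in> \<Omega> n" and as: "as \<in> tuples A n" and cs: "cs \<in> fibs (forget ?N) as" for n \<omega> as cs
  proof -
    let ?b = "opn A \<omega> as"
    have b: "?b \<in> car A"
      using A \<omega> as by (simp add: is_algebra_def)
    have cs': "cs \<in> carrier (product_group_list (map (grp ?N) as))"
      using cs by (simp add: fibs_forget)
    then obtain xs where xs: "xs \<in> carrier (product_group_list (map (grp ?F) as))"
      and cs_eq: "cs = map2 (coset_map ?F ?K) as xs"
      unfolding modulization_def carrier_quotient_product by blast
    have mop_cs: "mop ?N \<omega> as cs = coset_map ?F ?K ?b (mop ?F \<omega> as xs)"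
      unfolding modulization_def cs_eq by (rule mop_quotient_module[OF A F K \<omega> as xs])
    have "\<xi> ?b (mop ?N \<omega> as cs) = g ?b (mop ?N \<omega> as cs)"
      using hom_in_carrier[OF module_mop_hom[OF is_module_modulization[OF A P] \<omega> as] cs'] b
      by (simp add: \<xi>g)
    also have "\<dots> = h ?b (mop ?F \<omega> as xs)"
      unfolding mop_cs using hom_in_carrier[OF module_mop_hom[OF F \<omega> as] xs]
      by (intro gh[OF b]) simp
    also have "\<dots> = mop M \<omega> as (map2 h as xs)"
      by (rule free_extension_mop[OF A P M \<zeta> h h\<zeta> \<omega> as xs])
    \<comment> \<open>The entry \<open>cs ! i\<close> is the coset of \<open>xs ! i\<close>, and
      \<open>g\<close> maps this coset to the value of \<open>h\<close> at
      \<open>xs ! i\<close>.\<close>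
    also have "map2 h as xs = map2 \<xi> as cs"
    proof (rule nth_equalityI)
      fix i assume "i < length (map2 h as xs)"
      then have i: "i < length as" "i < length xs" "as ! i \<in> car A"
        using as by (auto simp: tuples_iff)
      then have "xs ! i \<in> carrier (free_Abelian_group (fib P (as ! i)))"
        "cs ! i \<in> carrier (grp ?N (as ! i))" "cs ! i = coset_map ?F ?K (as ! i) (xs ! i)"
        using xs cs' by (auto simp: carrier_product_group_list_iff cs_eq)
      then show "map2 h as xs ! i = map2 \<xi> as cs ! i"
        using i gh \<xi>g by (simp add: cs_eq)
    qed (simp add: cs_eq)
    finally show ?thesis .
  qed
  ultimately have "\<xi> \<in> module_hom \<Omega> A ?N M"
    by (auto simp: module_hom_def)
  moreover have "\<zeta> = family_comp A P \<xi> ?\<eta>"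
  proof (intro ext)
    fix a p
    show "\<zeta> a p = family_comp A P \<xi> ?\<eta> a p"
    proof (cases "a \<in> car A \<and> p \<in> fib P a")
      case True
      then have "\<xi> a (?\<eta> a p) = g a (coset_map ?F ?K a (frag_of p))"
        using \<xi>g modulization_unit_in_carrier modulization_unit_eq by metis
      then show ?thesis
        using True gh h\<zeta> by (simp add: family_comp_def compose_def)
    next
      \<comment> \<open>Both sides are \<open>undefined\<close> here, by extensionality of
        \<open>\<zeta>\<close> and by the definition of \<open>family_comp\<close>.\<close>
      case False
      then show ?thesis
        using \<zeta> by (auto simp: pointed_hom_def family_comp_def compose_def PiE_iff extensional_def)
    qed
  qed
  ultimately show thesis by (rule that)
qed

theorem theorem7p3:
  fixes \<Omega> :: "nat \<Rightarrow> 'f set"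
    and A :: "('f, 'a) alg"
    and P :: "('f, 'a, 'p) pointed_overalgebra"
    and E :: "'f identity set"
  assumes "is_algebra \<Omega> A"
    and "is_pointed_overalgebra \<Omega> A P"
    and "E \<subseteq> identities \<Omega>"
    and "in_variety \<Omega> E A"
  shows "(\<forall>e\<in>identities \<Omega>. satisfies A P e \<longrightarrow> satisfies A (forget (modulization \<Omega> A P)) e) \<and>
         (totally_in \<Omega> E A P \<longrightarrow> totally_in \<Omega> E A (forget (modulization \<Omega> A P))) \<and>
         (totally_in \<Omega> E A P \<longrightarrow>
            universal_arrow TYPE('m) \<Omega> A E P (modulization \<Omega> A P) (modulization_unit \<Omega> A P))"
proof -
  note A = assms(1) and P = assms(2)
  let ?N = "modulization \<Omega> A P"
  note N = is_module_modulization[OF A P]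
  have 1: "satisfies A (forget ?N) e" if "e \<in> identities \<Omega>" "satisfies A P e" for e
    using satisfies_modulization[OF A P that] .
  \<comment> \<open>Both memberships mean that every identity in \<open>E\<close> is satisfied, so
    part (1) is applied to the members of \<open>E\<close>.\<close>
  have 2: "totally_in \<Omega> E A (forget ?N)" if "totally_in \<Omega> E A P"
    using that 1 assms(3) totally_in_iff[OF A P assms(3,4)]
      totally_in_iff[OF A is_pointed_overalgebra_forget[OF A N] assms(3,4)] by blast
  have "universal_arrow TYPE('m) \<Omega> A E P ?N (modulization_unit \<Omega> A P)" if "totally_in \<Omega> E A P"
    unfolding universal_arrow_def
  proof (intro conjI allI impI ballI)
    show "Pnt_obj \<Omega> A E P" "Ab_obj \<Omega> A E ?N"
      using P N that 2 by (auto simp: Pnt_obj_def Ab_obj_def)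
    show "modulization_unit \<Omega> A P \<in> pointed_hom \<Omega> A P (forget ?N)"
      by (rule modulization_unit_hom[OF A P])
    fix M :: "('f, 'a, 'm) amodule" and \<zeta>
    assume "Ab_obj \<Omega> A E M" and \<zeta>: "\<zeta> \<in> pointed_hom \<Omega> A P (forget M)"
    then have M: "is_module \<Omega> A M"
      by (simp add: Ab_obj_def)
    from modulization_hom_exists[OF A P M \<zeta>]
    show "\<exists>!\<xi>. \<xi> \<in> module_hom \<Omega> A ?N M \<and> \<zeta> = family_comp A P \<xi> (modulization_unit \<Omega> A P)"
      using modulization_hom_unique[OF A P M] by metis
  qed
  with 1 2 show ?thesis by blast
qed

end
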